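(* Let $BP_n$ be the braid-permutation group, with standard generators $\sigma_i,\xi_i$ ($1\le i\le n-1$). Put $\sigma=\sigma_1\sigma_2\cdots\sigma_{n-1}$. Then the group $BP_n$ has a presentation with generators $\sigma_1,\ \sigma,\ \xi_1$ and relations $$\begin{cases} \sigma_1\sigma^i\sigma_1\sigma^{-i}=\sigma^i\sigma_1\sigma^{-i}\sigma_1 & \text{for } 2\le i\le n/2,\\ \sigma^n=(\sigma\sigma_1)^{n-1},\\ \xi_1\sigma^i\sigma_1\sigma^{-i}=\sigma^i\sigma_1\sigma^{-i}\xi_1 & \text{for } i=2,\dots,n-2,\\ \xi_1\sigma^i\xi_1\sigma^{-i}=\sigma^i\xi_1\sigma^{-i}\xi_1 & \text{for } i=2,\dots,n-2,\\ \xi_1\sigma\xi_1\sigma^{-1}\sigma_1=\sigma\sigma_1\sigma^{-1}\xi_1\sigma\xi_1\sigma^{-1},\\ \xi_1\sigma\xi_1\sigma^{-1}\xi_1=\sigma\xi_1\sigma^{-1}\xi_1\sigma\xi_1\sigma^{-1},\\ \xi_1^2=1. \end{cases}$$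
   Context: Let $F_n$ be the free group on $x_1,\dots,x_n$. The braid-permutation group $BP_n$ is the subgroup of $\operatorname{Aut}F_n$ generated by the automorphisms $\sigma_i$ ($1\le i\le n-1$): $x_i\mapsto x_{i+1}$, $x_{i+1}\mapsto x_{i+1}^{-1}x_ix_{i+1}$, $x_j\mapsto x_j$ for $j\ne i,i+1$; and $\xi_i$ ($1\le i\le n-1$): $x_i\mapsto x_{i+1}$, $x_{i+1}\mapsto x_i$, $x_j\mapsto x_j$ for $j\neq i,i+1$. By a theorem of Fenn, Rimányi and Rourke (known), $BP_n$ is presented by the generators $\xi_i,\sigma_i$ ($1\le i\le n-1$) and the relations: $\xi_i^2=1$; $\xi_i\xi_j=\xi_j\xi_i$ if $|i-j|>1$; $\xi_i\xi_{i+1}\xi_i=\xi_{i+1}\xi_i\xi_{i+1}$; $\sigma_i\sigma_j=\sigma_j\sigma_i$ if $|i-j|>1$; $\sigma_i\sigma_{i+1}\sigma_i=\sigma_{i+1}\sigma_i\sigma_{i+1}$; $\sigma_i\xi_j=\xi_j\sigma_i$ if $|i-j|>1$; $\xi_i\xi_{i+1}\sigma_i=\sigma_{i+1}\xi_i\xi_{i+1}$; $\sigma_i\sigma_{i+1}\xi_i=\xi_{i+1}\sigma_i\sigma_{i+1}$. The generator symbols of the presentation in the claim are interpreted as the elements of $BP_n$ with the same names.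
   Formalization: The formal theorem assumes n ≥ 3: for n = 2 we have σ = σ_1 and the fifth relation would give ξ_1σ_1ξ_1σ_1 = σ_1ξ_1σ_1ξ_1, which fails in BP_2; for n ≤ 1 there are no σ_1, ξ_1. *)

theory Defs
  imports "HOL-Algebra.Bij" "HOL-Algebra.Coset" "HOL-Algebra.Generated_Groups"
begin

section \<open>Free groups\<close>

text \<open>Words are lists of letters; \<open>(x, True)\<close> stands for the generator \<open>x\<close> and
  \<open>(x, False)\<close> for its formal inverse.\<close>

type_synonym 'a word = "('a \<times> bool) list"

definition cancels :: "'a \<times> bool \<Rightarrow> 'a \<times> bool \<Rightarrow> bool" where
  "cancels p q \<longleftrightarrow> fst p = fst q \<and> snd p \<noteq> snd q"

definition reduced :: "'a word \<Rightarrow> bool" where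
  "reduced w \<longleftrightarrow> successively (\<lambda>p q. \<not> cancels p q) w"

fun push :: "'a \<times> bool \<Rightarrow> 'a word \<Rightarrow> 'a word" where
  "push p [] = [p]"
| "push p (q # w) = (if cancels p q then w else p # q # w)"

definition reduce :: "'a word \<Rightarrow> 'a word" where
  "reduce w = foldr push w []"

definition free_group :: "'a set \<Rightarrow> 'a word monoid" where
  "free_group X =
     \<lparr>carrier = {w. reduced w \<and> fst ` set w \<subseteq> X}, mult = (\<lambda>u v. reduce (u @ v)), one = []\<rparr>"

definition free_gen :: "'a \<Rightarrow> 'a word" where
  "free_gen x = [(x, True)]"

definition free_lift :: "('b, 'c) monoid_scheme \<Rightarrow> ('a \<Rightarrow> 'b) \<Rightarrow> 'a word \<Rightarrow> 'b" where
  "free_lift G f w =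
     foldr (\<lambda>p g. (if snd p then f (fst p) else inv\<^bsub>G\<^esub> (f (fst p))) \<otimes>\<^bsub>G\<^esub> g) w \<one>\<^bsub>G\<^esub>"

lemma reduced_push: "reduced w \<Longrightarrow> reduced (push p w)"
  by (cases w) (auto simp: reduced_def successively_Cons)

lemma set_push: "set (push p w) \<subseteq> insert p (set w)"
  by (cases w) auto

lemma reduced_foldr: "reduced v \<Longrightarrow> reduced (foldr push w v)"
  by (induction w) (auto intro: reduced_push)

lemma reduced_reduce: "reduced (reduce w)"
  unfolding reduce_def by (rule reduced_foldr) (simp add: reduced_def)

lemma set_reduce: "set (reduce w) \<subseteq> set w"
  unfolding reduce_def by (induction w) (use set_push in fastforce)+

lemma reduce_id: "reduced w \<Longrightarrow> reduce w = w"
proof (induction w)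
  case (Cons p w)
  then show ?case
    by (cases w) (auto simp: reduced_def reduce_def)
qed (simp add: reduce_def)

lemma push_push_cancel:
  assumes "reduced v" "cancels p q" shows "push p (push q v) = v"
proof (cases v)
  case (Cons r w)
  show ?thesis
  proof (cases "cancels q r")
    case True
    with assms have "p = r" by (auto simp: cancels_def prod_eq_iff)
    with True Cons assms show ?thesis
      by (cases w) (auto simp: reduced_def cancels_def)
  qed (use assms Cons in auto)
qed (use assms in auto)

lemma foldr_reduce: "reduced v \<Longrightarrow> foldr push (reduce u) v = foldr push u v"
proof (induction u)
  case (Cons p u)
  have *: "foldr push (push p w) v = push p (foldr push w v)" for w
  proof (cases w)
    case (Cons q w')
    then show ?thesis
      using push_push_cancel[OF reduced_foldr[OF \<open>reduced v\<close>], of p q w'] by auto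
  qed auto
  show ?case
    using Cons * by (simp add: reduce_def)
qed (simp add: reduce_def)

lemma group_free_group: "group (free_group X)"
proof (rule groupI)
  fix u v w assume uvw: "u \<in> carrier (free_group X)" "v \<in> carrier (free_group X)" "w \<in> carrier (free_group X)"
  have "reduce (reduce (u @ v) @ w) = foldr push (reduce (u @ v)) (reduce w)"
    by (simp add: reduce_def)
  also have "\<dots> = foldr push u (reduce (v @ w))"
    by (simp add: foldr_reduce reduced_reduce) (simp add: reduce_def)
  also have "\<dots> = reduce (u @ reduce (v @ w))"
    using reduce_id[OF reduced_reduce, of "v @ w"] by (simp add: reduce_def)
  finally show "u \<otimes>\<^bsub>free_group X\<^esub> v \<otimes>\<^bsub>free_group X\<^esub> w = u \<otimes>\<^bsub>free_group X\<^esub> (v \<otimes>\<^bsub>free_group X\<^esub> w)"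
    by (simp add: free_group_def)
next
  fix u assume u: "u \<in> carrier (free_group X)"
  define v where "v = rev (map (\<lambda>(x, b). (x, \<not> b)) u)"
  have "foldr push (rev (map (\<lambda>(x, b). (x, \<not> b)) w)) (foldr push w z) = z" if "reduced z" for w z :: "'a word"
    using that
  proof (induction w)
    case (Cons p w)
    then show ?case
      using push_push_cancel[OF reduced_foldr[OF \<open>reduced z\<close>], of "(fst p, \<not> snd p)" p w]
      by (auto simp: cancels_def split: prod.splits)
  qed simp
  from this[of "[]" u] have "reduce (v @ u) = []"
    by (simp add: reduce_def v_def reduced_def)
  hence "reduce (reduce v @ u) = []"
    using foldr_reduce[OF reduced_reduce, of v u] by (simp add: reduce_def)
  moreover have "reduce v \<in> carrier (free_group X)"
    using u set_reduce[of v] reduced_reduce[of v] by (fastforce simp: free_group_def v_def)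
  ultimately show "\<exists>v\<in>carrier (free_group X). v \<otimes>\<^bsub>free_group X\<^esub> u = \<one>\<^bsub>free_group X\<^esub>"
    by (intro bexI[of _ "reduce v"]) (auto simp: free_group_def)
next
  fix u v assume "u \<in> carrier (free_group X)" "v \<in> carrier (free_group X)"
  then show "u \<otimes>\<^bsub>free_group X\<^esub> v \<in> carrier (free_group X)"
    using image_mono[OF set_reduce[of "u @ v"], of fst] reduced_reduce[of "u @ v"]
    by (simp add: free_group_def image_Un subset_trans[OF _ Un_least])
qed (auto simp: free_group_def reduce_id reduced_def[of "[]"])

lemma free_gen_in_carrier: "x \<in> X \<Longrightarrow> free_gen x \<in> carrier (free_group X)"
  by (simp add: free_gen_def free_group_def reduced_def)

lemma free_lift_in_carrier:
  assumes "group G" "\<And>x. x \<in> X \<Longrightarrow> f x \<in> carrier G" "fst ` set w \<subseteq> X"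
  shows "free_lift G f w \<in> carrier G"
proof -
  interpret group G by fact
  show ?thesis using assms(2,3) unfolding free_lift_def by (induction w) auto
qed

lemma free_lift_append:
  assumes "group G" "\<And>x. x \<in> X \<Longrightarrow> f x \<in> carrier G" "fst ` set u \<subseteq> X" "fst ` set v \<subseteq> X"
  shows "free_lift G f (u @ v) = free_lift G f u \<otimes>\<^bsub>G\<^esub> free_lift G f v"
proof -
  interpret group G by fact
  have mem: "fst ` set w \<subseteq> X \<Longrightarrow> free_lift G f w \<in> carrier G" for w
    using free_lift_in_carrier assms(1,2) by blast
  show ?thesis using assms(2,3,4)
  proof (induction u)
    case Nil
    then show ?case using mem[of v] by (simp add: free_lift_def)
  next
    case (Cons p u)
    then show ?case using mem[of u] mem[of v] by (simp add: free_lift_def m_assoc)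
  qed
qed

lemma free_lift_reduce:
  assumes "group G" "\<And>x. x \<in> X \<Longrightarrow> f x \<in> carrier G" "fst ` set w \<subseteq> X"
  shows "free_lift G f (reduce w) = free_lift G f w"
  using assms(3)
proof (induction w)
  case (Cons p w)
  interpret group G by fact
  have push: "free_lift G f (push p z) = free_lift G f (p # z)" if "fst ` set z \<subseteq> X" for z
  proof (cases z)
    case (Cons q z')
    have "free_lift G f z' \<in> carrier G" "fst q \<in> X" "f (fst q) \<in> carrier G"
      using that Cons assms by (auto intro!: free_lift_in_carrier[of G X])
    then show ?thesis
      using Cons by (auto simp: free_lift_def cancels_def m_assoc[symmetric])
  qed simp
  have "fst ` set (reduce w) \<subseteq> X"
    using set_reduce[of w] Cons.prems by auto
  with push[of "reduce w"] Cons show ?case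
    by (simp add: reduce_def free_lift_def)
qed (simp add: reduce_def)

lemma free_lift_hom:
  assumes "group G" "\<And>x. x \<in> X \<Longrightarrow> f x \<in> carrier G"
  shows "free_lift G f \<in> hom (free_group X) G"
  using free_lift_in_carrier[of G X f] free_lift_append[of G X f] free_lift_reduce[of G X f] assms
  by (simp add: hom_def free_group_def image_Un Pi_def)

lemma free_lift_gen:
  assumes "group G" "f x \<in> carrier G"
  shows "free_lift G f (free_gen x) = f x"
proof -
  interpret group G by fact
  show ?thesis using assms(2) by (simp add: free_lift_def free_gen_def)
qed


section \<open>Group presentations\<close>

definition normal_closure :: "('a, 'b) monoid_scheme \<Rightarrow> 'a set \<Rightarrow> 'a set" where
  "normal_closure G A = carrier G \<inter> \<Inter>{N. N \<lhd> G \<and> A \<subseteq> N}"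

text \<open>A relation \<open>u = v\<close> is given by the pair \<open>(u, v)\<close> of elements of the free group.\<close>

definition relators :: "'a set \<Rightarrow> ('a word \<times> 'a word) set \<Rightarrow> 'a word set" where
  "relators X R = (\<lambda>(u, v). u \<otimes>\<^bsub>free_group X\<^esub> inv\<^bsub>free_group X\<^esub> v) ` R"

definition presented_group :: "'a set \<Rightarrow> ('a word \<times> 'a word) set \<Rightarrow> 'a word set monoid" where
  "presented_group X R = free_group X Mod normal_closure (free_group X) (relators X R)"

definition presented_gen :: "'a set \<Rightarrow> ('a word \<times> 'a word) set \<Rightarrow> 'a \<Rightarrow> 'a word set" where
  "presented_gen X R x =
     normal_closure (free_group X) (relators X R) #>\<^bsub>free_group X\<^esub> free_gen x"

text \<open>\<open>G\<close> is presented by the generators \<open>X\<close>, where \<open>x \<in> X\<close> is interpreted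
  as the element \<open>f x\<close> of \<open>G\<close>, and the relations \<open>R\<close>.\<close>

definition has_presentation ::
  "('b, 'c) monoid_scheme \<Rightarrow> 'a set \<Rightarrow> ('a \<Rightarrow> 'b) \<Rightarrow> ('a word \<times> 'a word) set \<Rightarrow> bool" where
  "has_presentation G X f R \<longleftrightarrow>
     group G \<and> (\<exists>h \<in> iso (presented_group X R) G. \<forall>x\<in>X. h (presented_gen X R x) = f x)"


section \<open>The braid-permutation group\<close>

abbreviation Fn :: "nat \<Rightarrow> nat word monoid" where
  "Fn n \<equiv> free_group {1..n}"

definition free_endo :: "nat \<Rightarrow> (nat \<Rightarrow> nat word) \<Rightarrow> nat word \<Rightarrow> nat word" where
  "free_endo n f = (\<lambda>w \<in> carrier (Fn n). free_lift (Fn n) f w)"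

definition bp_sigma :: "nat \<Rightarrow> nat \<Rightarrow> nat word \<Rightarrow> nat word" where
  "bp_sigma n i = free_endo n (\<lambda>j.
     if j = i then free_gen (i + 1)
     else if j = i + 1
       then inv\<^bsub>Fn n\<^esub> free_gen (i + 1) \<otimes>\<^bsub>Fn n\<^esub> free_gen i \<otimes>\<^bsub>Fn n\<^esub> free_gen (i + 1)
     else free_gen j)"

definition bp_xi :: "nat \<Rightarrow> nat \<Rightarrow> nat word \<Rightarrow> nat word" where
  "bp_xi n i = free_endo n (\<lambda>j.
     if j = i then free_gen (i + 1)
     else if j = i + 1 then free_gen i
     else free_gen j)"

text \<open>Automorphisms act from the right: in a product \<open>g h\<close> the factor \<open>g\<close> is applied first.
  This is the convention under which the mixed relations
  \<open>\<xi>\<^sub>i \<xi>\<^sub>i\<^sub>+\<^sub>1 \<sigma>\<^sub>i = \<sigma>\<^sub>i\<^sub>+\<^sub>1 \<xi>\<^sub>i \<xi>\<^sub>i\<^sub>+\<^sub>1\<close> and \<open>\<sigma>\<^sub>i \<sigma>\<^sub>i\<^sub>+\<^sub>1 \<xi>\<^sub>i = \<xi>\<^sub>i\<^sub>+\<^sub>1 \<sigma>\<^sub>i \<sigma>\<^sub>i\<^sub>+\<^sub>1\<close> hold for the automorphisms above.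
  The multiplication of \<^const>\<open>AutoGroup\<close> is composition of functions, hence the swap.\<close>

definition right_aut :: "nat \<Rightarrow> (nat word \<Rightarrow> nat word) monoid" where
  "right_aut n = AutoGroup (Fn n) \<lparr>mult := (\<lambda>g h. h \<otimes>\<^bsub>AutoGroup (Fn n)\<^esub> g)\<rparr>"

definition BP :: "nat \<Rightarrow> (nat word \<Rightarrow> nat word) monoid" where
  "BP n = right_aut n
     \<lparr>carrier := generate (right_aut n) (bp_sigma n ` {1..n-1} \<union> bp_xi n ` {1..n-1})\<rparr>"

definition bp_sigma_prod :: "nat \<Rightarrow> nat word \<Rightarrow> nat word" where
  "bp_sigma_prod n = foldr (mult (BP n)) (map (bp_sigma n) [1..<n]) \<one>\<^bsub>BP n\<^esub>"

lemma free_hom_eqI: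
  assumes "group G" "g \<in> hom (free_group X) G" "h \<in> hom (free_group X) G"
    and "\<And>x. x \<in> X \<Longrightarrow> g (free_gen x) = h (free_gen x)"
    and "w \<in> carrier (free_group X)"
  shows "g w = h w"
  using assms(5)
proof (induction w)
  case Nil
  have "[] = \<one>\<^bsub>free_group X\<^esub>" by (simp add: free_group_def)
  then show ?case
    using hom_one[OF assms(2) group_free_group assms(1)] hom_one[OF assms(3) group_free_group assms(1)]
    by simp
next
  case (Cons p w)
  interpret FG: group "free_group X" by (rule group_free_group)
  interpret g: group_hom "free_group X" G g
    using assms(1,2) group_free_group by (simp add: group_hom_def group_hom_axioms_def)
  interpret h: group_hom "free_group X" G h
    using assms(1,3) group_free_group by (simp add: group_hom_def group_hom_axioms_def)
  obtain x b where p: "p = (x, b)" by (cases p)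
  have x: "x \<in> X" using Cons.prems p by (auto simp: free_group_def)
  have w: "w \<in> carrier (free_group X)"
    using Cons.prems by (auto simp: free_group_def reduced_def successively_Cons)
  have letter: "[p] \<in> carrier (free_group X)"
    using x p by (simp add: free_group_def reduced_def)
  have split: "p # w = [p] \<otimes>\<^bsub>free_group X\<^esub> w"
    using Cons.prems reduce_id[of "p # w"] by (simp add: free_group_def)
  have "[p] = (if b then free_gen x else inv\<^bsub>free_group X\<^esub> free_gen x)"
  proof (cases b)
    case False
    have "[p] \<otimes>\<^bsub>free_group X\<^esub> free_gen x = \<one>\<^bsub>free_group X\<^esub>"
      using False p by (simp add: free_group_def free_gen_def reduce_def cancels_def)
    then show ?thesis
      using FG.inv_equality[of "[p]" "free_gen x"] letter free_gen_in_carrier[OF x] False by simp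
  qed (simp add: p free_gen_def)
  then have "g [p] = h [p]"
    using assms(4)[OF x] free_gen_in_carrier[OF x] by simp
  then show ?case
    using split letter w Cons.IH[OF w] by simp
qed

context
  notes One_nat_def [simp del]
begin

lemma free_endo_auto:
  assumes f: "\<And>j. j \<in> {1..n} \<Longrightarrow> f j \<in> carrier (Fn n)"
    and f': "\<And>j. j \<in> {1..n} \<Longrightarrow> f' j \<in> carrier (Fn n)"
    and ff': "\<And>j. j \<in> {1..n} \<Longrightarrow> free_lift (Fn n) f' (f j) = free_gen j"
    and f'f: "\<And>j. j \<in> {1..n} \<Longrightarrow> free_lift (Fn n) f (f' j) = free_gen j"
  shows "free_endo n f \<in> auto (Fn n)"
proof -
  note G = group_free_group[of "{1..n}"]
  have hf: "free_lift (Fn n) f \<in> hom (Fn n) (Fn n)" and hf': "free_lift (Fn n) f' \<in> hom (Fn n) (Fn n)"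
    using free_lift_hom[OF G, of "{1..n}" f] free_lift_hom[OF G, of "{1..n}" f'] f f' by blast+
  have id: "(\<lambda>w. w) \<in> hom (Fn n) (Fn n)" by (simp add: hom_def)
  have 1: "free_lift (Fn n) f' (free_lift (Fn n) f w) = w" if "w \<in> carrier (Fn n)" for w
    using free_hom_eqI[OF G hom_compose[OF hf hf'] id _ that] free_lift_gen[OF G, of f, OF f] ff'
    by simp
  have 2: "free_lift (Fn n) f (free_lift (Fn n) f' w) = w" if "w \<in> carrier (Fn n)" for w
    using free_hom_eqI[OF G hom_compose[OF hf' hf] id _ that] free_lift_gen[OF G, of f', OF f'] f'f
    by simp
  have "bij_betw (free_lift (Fn n) f) (carrier (Fn n)) (carrier (Fn n))"
    using 1 2 hom_in_carrier[OF hf] hom_in_carrier[OF hf']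
    by (intro bij_betw_byWitness[where f' = "free_lift (Fn n) f'"]) auto
  then have "bij_betw (free_endo n f) (carrier (Fn n)) (carrier (Fn n))"
    by (subst bij_betw_cong[where g = "free_lift (Fn n) f"]) (simp_all add: free_endo_def)
  moreover have "free_endo n f \<in> hom (Fn n) (Fn n)"
  proof -
    interpret FG: group "Fn n" by (rule G)
    show ?thesis
      using hf by (auto simp: free_endo_def hom_def)
  qed
  ultimately show ?thesis
    by (simp add: auto_def Bij_def free_endo_def)
qed

lemma bp_xi_auto:
  assumes "i \<in> {1..n-1}" shows "bp_xi n i \<in> auto (Fn n)"
proof -
  note G = group_free_group[of "{1..n}"]
  show ?thesis
    unfolding bp_xi_def using assms
    by (intro free_endo_auto[where f' = "\<lambda>j. if j = i then free_gen (i + 1)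
        else if j = i + 1 then free_gen i else free_gen j"])
       (auto simp: free_lift_gen[OF G] free_gen_in_carrier)
qed

lemma bp_sigma_auto:
  assumes "i \<in> {1..n-1}" shows "bp_sigma n i \<in> auto (Fn n)"
proof -
  note G = group_free_group[of "{1..n}"]
  interpret FG: group "Fn n" by (rule G)
  let ?f = "\<lambda>j. if j = i then free_gen (i + 1)
     else if j = i + 1
       then inv\<^bsub>Fn n\<^esub> free_gen (i + 1) \<otimes>\<^bsub>Fn n\<^esub> free_gen i \<otimes>\<^bsub>Fn n\<^esub> free_gen (i + 1)
     else free_gen j"
  let ?f' = "\<lambda>j. if j = i then free_gen i \<otimes>\<^bsub>Fn n\<^esub> free_gen (i + 1) \<otimes>\<^bsub>Fn n\<^esub> inv\<^bsub>Fn n\<^esub> free_gen i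
     else if j = i + 1 then free_gen i else free_gen j"
  have cancel: "a \<otimes>\<^bsub>Fn n\<^esub> (inv\<^bsub>Fn n\<^esub> a \<otimes>\<^bsub>Fn n\<^esub> b) = b"
    "inv\<^bsub>Fn n\<^esub> a \<otimes>\<^bsub>Fn n\<^esub> (a \<otimes>\<^bsub>Fn n\<^esub> b) = b"
    if "a \<in> carrier (Fn n)" "b \<in> carrier (Fn n)" for a b
    using that by (simp_all add: FG.m_assoc[symmetric])
  have mem: "free_gen j \<in> carrier (Fn n)" if "j \<in> {1..n}" for j
    using that by (rule free_gen_in_carrier)
  have i: "free_gen i \<in> carrier (Fn n)" "free_gen (i + 1) \<in> carrier (Fn n)"
    "free_gen (Suc i) \<in> carrier (Fn n)"
    using assms by (auto intro!: mem)
  have f: "?f j \<in> carrier (Fn n)" and f': "?f' j \<in> carrier (Fn n)" if "j \<in> {1..n}" for j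
    using i mem[OF that] by auto
  interpret f: group_hom "Fn n" "Fn n" "free_lift (Fn n) ?f"
    using free_lift_hom[OF G, of "{1..n}" ?f] f G by (simp add: group_hom_def group_hom_axioms_def)
  interpret f': group_hom "Fn n" "Fn n" "free_lift (Fn n) ?f'"
    using free_lift_hom[OF G, of "{1..n}" ?f'] f' G by (simp add: group_hom_def group_hom_axioms_def)
  have gen: "free_lift (Fn n) ?f (free_gen j) = ?f j" "free_lift (Fn n) ?f' (free_gen j) = ?f' j"
    if "j \<in> {1..n}" for j
    using free_lift_gen[OF G, of ?f j] free_lift_gen[OF G, of ?f' j] f[OF that] f'[OF that] by blast+
  have "i \<in> {1..n}" "i + 1 \<in> {1..n}" using assms by auto
  note gi = gen[OF this(1)] gen[OF this(2)]
  show ?thesis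
    unfolding bp_sigma_def
  proof (rule free_endo_auto[where f' = ?f'])
    fix j assume j: "j \<in> {1..n}"
    show "?f j \<in> carrier (Fn n)" "?f' j \<in> carrier (Fn n)" using f f' j by blast+
    consider "j = i" | "j = i + 1" | "j \<noteq> i" "j \<noteq> i + 1" by blast
    then have "free_lift (Fn n) ?f' (?f j) = free_gen j \<and> free_lift (Fn n) ?f (?f' j) = free_gen j"
    proof cases
      case 1
      have "free_lift (Fn n) ?f (free_gen i \<otimes>\<^bsub>Fn n\<^esub> free_gen (i + 1) \<otimes>\<^bsub>Fn n\<^esub> inv\<^bsub>Fn n\<^esub> free_gen i) = free_gen i"
        using i unfolding f.hom_mult[OF FG.m_closed[OF i(1,2)] FG.inv_closed[OF i(1)]]
          f.hom_mult[OF i(1,2)] f.hom_inv[OF i(1)] gi by (simp add: FG.m_assoc cancel)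
      with 1 gi show ?thesis by simp
    next
      case 2
      have "free_lift (Fn n) ?f' (inv\<^bsub>Fn n\<^esub> free_gen (i + 1) \<otimes>\<^bsub>Fn n\<^esub> free_gen i \<otimes>\<^bsub>Fn n\<^esub> free_gen (i + 1)) = free_gen (i + 1)"
        using i unfolding f'.hom_mult[OF FG.m_closed[OF FG.inv_closed[OF i(2)] i(1)] i(2)]
          f'.hom_mult[OF FG.inv_closed[OF i(2)] i(1)] f'.hom_inv[OF i(2)] gi
        by (simp add: FG.m_assoc cancel)
      with 2 gi show ?thesis by simp
    next
      case 3
      then show ?thesis using gen[OF j] by simp
    qed
    then show "free_lift (Fn n) ?f' (?f j) = free_gen j" "free_lift (Fn n) ?f (?f' j) = free_gen j"
      by blast+
  qed
qed

lemma group_right_aut: "group (right_aut n)"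
proof -
  interpret A: group "AutoGroup (Fn n)" by (rule group.AutoGroup[OF group_free_group])
  show ?thesis
  proof (rule groupI)
    fix g assume "g \<in> carrier (right_aut n)"
    then show "\<exists>h\<in>carrier (right_aut n). h \<otimes>\<^bsub>right_aut n\<^esub> g = \<one>\<^bsub>right_aut n\<^esub>"
      by (intro bexI[of _ "inv\<^bsub>AutoGroup (Fn n)\<^esub> g"])
         (simp_all add: right_aut_def A.r_inv A.inv_closed)
  qed (simp_all add: right_aut_def A.m_assoc)
qed

lemma group_BP: "group (BP n)"
proof -
  interpret group "right_aut n" by (rule group_right_aut)
  have "bp_sigma n ` {1..n-1} \<union> bp_xi n ` {1..n-1} \<subseteq> carrier (right_aut n)"
    using bp_sigma_auto bp_xi_auto by (auto simp: right_aut_def AutoGroup_def)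
  from subgroup.subgroup_is_group[OF generate_is_subgroup[OF this]] show ?thesis
    by (simp add: BP_def group_right_aut)
qed

end


section \<open>The presentation on three generators\<close>

datatype bp_symbol = Sigma_1 | Sigma_prod | Xi_1

primrec bp_interp :: "nat \<Rightarrow> bp_symbol \<Rightarrow> nat word \<Rightarrow> nat word" where
  "bp_interp n Sigma_1 = bp_sigma n 1"
| "bp_interp n Sigma_prod = bp_sigma_prod n"
| "bp_interp n Xi_1 = bp_xi n 1"

definition bp_relations :: "nat \<Rightarrow> (bp_symbol word \<times> bp_symbol word) set" where
  "bp_relations n =
    (let S = free_group (UNIV :: bp_symbol set);
         s1 = free_gen Sigma_1; s = free_gen Sigma_prod; x1 = free_gen Xi_1
     in
       {(s1 \<otimes>\<^bsub>S\<^esub> s [^]\<^bsub>S\<^esub> i \<otimes>\<^bsub>S\<^esub> s1 \<otimes>\<^bsub>S\<^esub> s [^]\<^bsub>S\<^esub> (- i),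
         s [^]\<^bsub>S\<^esub> i \<otimes>\<^bsub>S\<^esub> s1 \<otimes>\<^bsub>S\<^esub> s [^]\<^bsub>S\<^esub> (- i) \<otimes>\<^bsub>S\<^esub> s1)
        | i :: int. 2 \<le> i \<and> 2 * i \<le> int n} \<union>
       {(s [^]\<^bsub>S\<^esub> n, (s \<otimes>\<^bsub>S\<^esub> s1) [^]\<^bsub>S\<^esub> (n - 1))} \<union>
       {(x1 \<otimes>\<^bsub>S\<^esub> s [^]\<^bsub>S\<^esub> i \<otimes>\<^bsub>S\<^esub> s1 \<otimes>\<^bsub>S\<^esub> s [^]\<^bsub>S\<^esub> (- i),
         s [^]\<^bsub>S\<^esub> i \<otimes>\<^bsub>S\<^esub> s1 \<otimes>\<^bsub>S\<^esub> s [^]\<^bsub>S\<^esub> (- i) \<otimes>\<^bsub>S\<^esub> x1)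
        | i :: int. 2 \<le> i \<and> i \<le> int n - 2} \<union>
       {(x1 \<otimes>\<^bsub>S\<^esub> s [^]\<^bsub>S\<^esub> i \<otimes>\<^bsub>S\<^esub> x1 \<otimes>\<^bsub>S\<^esub> s [^]\<^bsub>S\<^esub> (- i),
         s [^]\<^bsub>S\<^esub> i \<otimes>\<^bsub>S\<^esub> x1 \<otimes>\<^bsub>S\<^esub> s [^]\<^bsub>S\<^esub> (- i) \<otimes>\<^bsub>S\<^esub> x1)
        | i :: int. 2 \<le> i \<and> i \<le> int n - 2} \<union>
       {(x1 \<otimes>\<^bsub>S\<^esub> s \<otimes>\<^bsub>S\<^esub> x1 \<otimes>\<^bsub>S\<^esub> inv\<^bsub>S\<^esub> s \<otimes>\<^bsub>S\<^esub> s1,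
         s \<otimes>\<^bsub>S\<^esub> s1 \<otimes>\<^bsub>S\<^esub> inv\<^bsub>S\<^esub> s \<otimes>\<^bsub>S\<^esub> x1 \<otimes>\<^bsub>S\<^esub> s \<otimes>\<^bsub>S\<^esub> x1 \<otimes>\<^bsub>S\<^esub> inv\<^bsub>S\<^esub> s),
        (x1 \<otimes>\<^bsub>S\<^esub> s \<otimes>\<^bsub>S\<^esub> x1 \<otimes>\<^bsub>S\<^esub> inv\<^bsub>S\<^esub> s \<otimes>\<^bsub>S\<^esub> x1,
         s \<otimes>\<^bsub>S\<^esub> x1 \<otimes>\<^bsub>S\<^esub> inv\<^bsub>S\<^esub> s \<otimes>\<^bsub>S\<^esub> x1 \<otimes>\<^bsub>S\<^esub> s \<otimes>\<^bsub>S\<^esub> x1 \<otimes>\<^bsub>S\<^esub> inv\<^bsub>S\<^esub> s),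
        (x1 [^]\<^bsub>S\<^esub> (2 :: nat), \<one>\<^bsub>S\<^esub>)})"

end

theory Submission
  imports Defs "HOL-Combinatorics.Permutations"
begin

text \<open>Conjugation by powers of \<open>\<sigma>\<close> turns the relations on three generators into those of Fenn,
  Rimanyi and Rourke on all \<open>\<sigma>\<^sub>i, \<xi>\<^sub>i\<close> and back, \<open>\<sigma>\<^sup>n\<close> being central in the subgroup generated by \<open>\<sigma>\<close>
  and \<open>\<sigma>\<^sub>1\<close>. What remains is that a group \<open>W\<close> with the latter relations acts faithfully.
  In \<open>W\<close> the \<open>\<xi>\<^sub>i\<close> generate an image of the symmetric group, and the conjugates of \<open>\<xi>\<^sub>1 \<sigma>\<^sub>1\<close> under it give
  elements \<open>a\<^sub>i\<^sub>j\<close> that satisfy McCool's relations. Encode the automorphisms as tuples \<open>(y\<^sub>1, \<dots>, y\<^sub>n)\<close> with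
  \<open>y\<^sub>i\<close> conjugate to \<open>x\<^sub>i\<close>, on which \<open>a\<^sub>i\<^sub>j\<close> replaces \<open>y\<^sub>i\<close> by \<open>y\<^sub>j\<^sup>-\<^sup>1 y\<^sub>i y\<^sub>j\<close>. Each such move changes the total
  length strictly, and two shortening moves can be joined below the original length by McCool's
  relations. So shortening a tuple step by step assigns to it a well-defined element of \<open>W\<close>; it
  recovers each element of \<open>W\<close> from the tuple it produces.\<close>

section \<open>Groups as a type class\<close>

text \<open>The hard half is that a word acting trivially lies in the normal closure of the
  relators. This is tested by evaluation: it suffices that the word evaluates to 1 in every group
  satisfying the relations, since the quotient by the normal closure is one of them. Hence the type
  class: evaluation in an arbitrary group needs no membership conditions, and Cayley's theorem
  brings the quotient in. No normal form of group elements is used. Instead a function from tuples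
  to the group is sought that is multiplied on the left by a_ij under the corresponding move; its
  existence expresses that the relations fill every loop of moves. Peak reduction in the style of
  Whitehead usually has to deal with steps that keep the length. Here a move conjugates a single
  entry and never preserves its length, so only genuine peaks remain. The permutations, which do
  preserve the total length, are split off as a separate factor, and the same lemma on potentials
  treats them with another weight.\<close>

class group_mult = monoid_mult +
  fixes minv :: "'a \<Rightarrow> 'a"
  assumes minv_left [simp]: "minv a * a = 1"
begin

lemma minv_right [simp]: "a * minv a = 1"
proof -
  have "a * minv a = (minv (minv a) * minv a) * (a * minv a)"
    by simp
  also have "\<dots> = minv (minv a) * (minv a * a) * minv a"
    by (simp only: mult_assoc)
  finally show ?thesis
    by simp
qed

lemma minv_cancel_left [simp]: "minv a * (a * b) = b" "a * (minv a * b) = b"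
  by (simp_all flip: mult_assoc)

lemma mult_left_cancel_group: "a * b = a * c \<longleftrightarrow> b = c"
  by (metis minv_cancel_left(1))

lemma mult_right_cancel_group: "b * a = c * a \<longleftrightarrow> b = c"
  by (metis minv_right mult_assoc mult_1_right)

lemma minv_unique: "a * b = 1 \<Longrightarrow> minv a = b"
  by (metis minv_cancel_left(1) mult_1_right)

lemma minv_minv [simp]: "minv (minv a) = a"
  by (rule minv_unique) simp

lemma minv_one [simp]: "minv 1 = 1"
  by (rule minv_unique) simp

lemma minv_mult: "minv (a * b) = minv b * minv a"
  by (rule minv_unique) (simp add: mult_assoc)

lemma minv_mult_eq_iff: "minv a * b = c \<longleftrightarrow> b = a * c"
  by (metis minv_cancel_left)

lemma commute_minv: "a * b = b * a \<Longrightarrow> minv a * b = b * minv a"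
  by (metis minv_cancel_left(1) minv_right mult_assoc mult_1_right)

lemma commute_mult: "a * c = c * a \<Longrightarrow> b * c = c * b \<Longrightarrow> (a * b) * c = c * (a * b)"
  by (metis mult_assoc)

lemma commute_prod_list: "(\<And>x. x \<in> set xs \<Longrightarrow> x * a = a * x) \<Longrightarrow> prod_list xs * a = a * prod_list xs"
  by (induction xs) (auto intro: commute_mult)

definition cnj :: "'a \<Rightarrow> 'a \<Rightarrow> 'a" where
  "cnj g a = g * a * minv g"

lemma cnj_mult: "cnj g (a * b) = cnj g a * cnj g b"
  by (simp add: cnj_def mult_assoc)

lemma cnj_one [simp]: "cnj g 1 = 1"
  by (simp add: cnj_def)

lemma cnj_cnj: "cnj g (cnj h a) = cnj (g * h) a"
  by (simp add: cnj_def minv_mult mult_assoc)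

lemma cnj_minv: "cnj g (minv a) = minv (cnj g a)"
  by (simp add: cnj_def minv_mult mult_assoc)

lemma cnj_eq_iff: "cnj g a = cnj g b \<longleftrightarrow> a = b"
  by (simp add: cnj_def mult_left_cancel_group mult_right_cancel_group)

lemma cnj_commute: "g * a = a * g \<Longrightarrow> cnj g a = a"
  by (simp add: cnj_def mult_assoc)

lemma cnj_prod_list: "cnj g (prod_list xs) = prod_list (map (cnj g) xs)"
  by (induction xs) (simp_all add: cnj_mult)

end

lemmas group_norm = mult.assoc minv_mult

section \<open>Evaluation of words in a group\<close>

definition letter :: "('a \<Rightarrow> 'g::group_mult) \<Rightarrow> 'a \<times> bool \<Rightarrow> 'g" where
  "letter f p = (if snd p then f (fst p) else minv (f (fst p)))"

definition word_lift :: "('a \<Rightarrow> 'g::group_mult) \<Rightarrow> 'a word \<Rightarrow> 'g" where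
  "word_lift f w = prod_list (map (letter f) w)"

lemma word_lift_simps [simp]:
  "word_lift f [] = 1"
  "word_lift f (p # w) = letter f p * word_lift f w"
  "word_lift f (u @ v) = word_lift f u * word_lift f v"
  by (simp_all add: word_lift_def)

lemma word_lift_free_gen [simp]: "word_lift f (free_gen x) = f x"
  by (simp add: free_gen_def letter_def)

lemma letter_cancels: "cancels p q \<Longrightarrow> letter f p * (letter f q * a) = a"
  by (auto simp: cancels_def letter_def)

lemma word_lift_push: "word_lift f (push p w) = letter f p * word_lift f w"
  by (cases w) (auto simp: letter_cancels)

lemma word_lift_reduce: "word_lift f (reduce w) = word_lift f w"
  unfolding reduce_def by (induction w) (auto simp: word_lift_push)

lemma word_lift_mult: "word_lift f (u \<otimes>\<^bsub>free_group X\<^esub> v) = word_lift f u * word_lift f v"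
  by (simp add: free_group_def word_lift_reduce)

lemma word_lift_one: "word_lift f \<one>\<^bsub>free_group X\<^esub> = 1"
  by (simp add: free_group_def)

lemma word_lift_inv:
  assumes "u \<in> carrier (free_group X)"
  shows "word_lift f (inv\<^bsub>free_group X\<^esub> u) = minv (word_lift f u)"
proof -
  interpret group "free_group X" by (rule group_free_group)
  have "word_lift f u * word_lift f (inv\<^bsub>free_group X\<^esub> u) = 1"
    using r_inv[OF assms] by (metis word_lift_mult word_lift_one)
  then show ?thesis
    by (metis minv_unique)
qed

lemma word_lift_nat_pow: "word_lift f (u [^]\<^bsub>free_group X\<^esub> (k::nat)) = word_lift f u ^ k"
proof -
  interpret group "free_group X" by (rule group_free_group)
  show ?thesis
    by (induction k) (simp_all add: word_lift_mult word_lift_one power_commutes)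
qed

lemma word_lift_int_pow:
  assumes "u \<in> carrier (free_group X)"
  shows "word_lift f (u [^]\<^bsub>free_group X\<^esub> (int k)) = word_lift f u ^ k"
    and "word_lift f (u [^]\<^bsub>free_group X\<^esub> (- int k)) = minv (word_lift f u ^ k)"
proof -
  interpret group "free_group X" by (rule group_free_group)
  show "word_lift f (u [^]\<^bsub>free_group X\<^esub> (int k)) = word_lift f u ^ k"
    by (simp add: int_pow_int word_lift_nat_pow)
  show "word_lift f (u [^]\<^bsub>free_group X\<^esub> (- int k)) = minv (word_lift f u ^ k)"
    using assms by (simp add: int_pow_neg_int word_lift_nat_pow word_lift_inv)
qed

text \<open>The bridge from groups with carriers to the type class: a map that is multiplicative on
  the carrier also preserves 1 and inverses, hence commutes with evaluating words.\<close>

lemma word_lift_free_lift: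
  assumes "group G" "\<And>x. f x \<in> carrier G"
    and mult: "\<And>a b. a \<in> carrier G \<Longrightarrow> b \<in> carrier G \<Longrightarrow> c (a \<otimes>\<^bsub>G\<^esub> b) = c a * c b"
  shows "c (free_lift G f w) = word_lift (\<lambda>x. c (f x)) w"
proof -
  interpret group G by fact
  have one: "c \<one>\<^bsub>G\<^esub> = 1"
    using mult[OF one_closed one_closed] by (metis l_one mult.right_neutral mult_left_cancel_group one_closed)
  have inv: "c (inv\<^bsub>G\<^esub> a) = minv (c a)" if "a \<in> carrier G" for a
    using mult[OF that inv_closed[OF that]] that one by (simp add: minv_unique)
  have clo: "free_lift G f w \<in> carrier G" for w
    using free_lift_in_carrier[of G UNIV f w] assms by simp
  show ?thesis
  proof (induction w)
    case (Cons p w)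
    have "free_lift G f (p # w) = (if snd p then f (fst p) else inv\<^bsub>G\<^esub> (f (fst p))) \<otimes>\<^bsub>G\<^esub> free_lift G f w"
      by (simp add: free_lift_def)
    then show ?case
      using Cons clo[of w] assms(2) by (auto simp: mult inv letter_def)
  qed (simp add: free_lift_def one)
qed


section \<open>The full group of bijections\<close>

typedef 'a permutation = "{f :: 'a \<Rightarrow> 'a. bij f}"
  morphisms perm_fun Perm by (rule exI[of _ id]) simp

instantiation permutation :: (type) group_mult
begin

definition "times_permutation g h = Perm (perm_fun g \<circ> perm_fun h)"
definition "one_permutation = Perm id"
definition "minv_permutation g = Perm (inv_into UNIV (perm_fun g))"

lemma bij_perm_fun: "bij (perm_fun g)"
  using perm_fun by auto

lemma perm_fun_mult [simp]: "perm_fun (g * h) = perm_fun g \<circ> perm_fun h"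
  by (simp add: times_permutation_def Perm_inverse bij_perm_fun bij_comp)

lemma perm_fun_one [simp]: "perm_fun 1 = id"
  by (simp add: one_permutation_def Perm_inverse)

lemma perm_fun_minv: "perm_fun (minv g) = inv_into UNIV (perm_fun g)"
  by (simp add: minv_permutation_def Perm_inverse bij_imp_bij_inv bij_perm_fun)

instance
proof
  fix a b c :: "'a permutation"
  show "a * b * c = a * (b * c)" "1 * a = a" "a * 1 = a" "minv a * a = 1"
    by (simp_all add: perm_fun_minv bij_perm_fun comp_assoc bij_is_inj flip: perm_fun_inject)
qed

end

lemma perm_fun_Perm: "bij f \<Longrightarrow> perm_fun (Perm f) = f"
  by (simp add: Perm_inverse)

lemma perm_fun_minv_cancel [simp]:
  "perm_fun (minv g) (perm_fun g x) = x" "perm_fun g (perm_fun (minv g) x) = x"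
  by (simp_all flip: perm_fun_mult comp_apply[of "perm_fun _"])

text \<open>Cayley's theorem moves an arbitrary group into the type class.\<close>

definition cayley :: "('a, 'b) monoid_scheme \<Rightarrow> 'a \<Rightarrow> 'a permutation" where
  "cayley G g = Perm (\<lambda>x. if x \<in> carrier G then g \<otimes>\<^bsub>G\<^esub> x else x)"

context group
begin

lemma perm_fun_cayley:
  assumes "g \<in> carrier G"
  shows "perm_fun (cayley G g) = (\<lambda>x. if x \<in> carrier G then g \<otimes> x else x)"
proof -
  have "bij (\<lambda>x. if x \<in> carrier G then g \<otimes> x else x)"
    by (rule bij_betw_byWitness[where f' = "\<lambda>x. if x \<in> carrier G then inv g \<otimes> x else x"])
      (use assms in \<open>auto simp: m_assoc[symmetric]\<close>)
  then show ?thesis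
    by (simp add: cayley_def perm_fun_Perm)
qed

lemma cayley_mult:
  assumes "g \<in> carrier G" "h \<in> carrier G"
  shows "cayley G (g \<otimes> h) = cayley G g * cayley G h"
  using assms by (auto simp: perm_fun_cayley fun_eq_iff m_assoc simp flip: perm_fun_inject)

lemma cayley_eq_one:
  assumes "g \<in> carrier G" "cayley G g = 1"
  shows "g = \<one>"
  using perm_fun_cayley[OF assms(1)] assms by (auto dest: fun_cong[of _ _ \<one>])

end

section \<open>The free group as a type\<close>

text \<open>The product of \<open>free_group X\<close> does not depend on \<open>X\<close>, so one
  free group on the whole type contains every \<open>Fn n\<close>, and n need not enter the
  type.\<close>

typedef 'a fg = "{w :: 'a word. reduced w}"
  by (rule exI[of _ "[]"]) (simp add: reduced_def)

instantiation fg :: (type) group_mult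
begin

definition "times_fg u v = Abs_fg (reduce (Rep_fg u @ Rep_fg v))"
definition "one_fg = Abs_fg ([] :: 'a word)"
definition "minv_fg u = Abs_fg (inv\<^bsub>free_group UNIV\<^esub> (Rep_fg u))"

lemma Rep_fg_mem: "Rep_fg u \<in> carrier (free_group UNIV)"
  using Rep_fg[of u] by (simp add: free_group_def)

lemma Rep_fg_Abs: "u \<in> carrier (free_group X) \<Longrightarrow> Rep_fg (Abs_fg u) = u"
  by (simp add: free_group_def Abs_fg_inverse)

lemma Rep_fg_mult: "Rep_fg (u * v) = Rep_fg u \<otimes>\<^bsub>free_group X\<^esub> Rep_fg v"
  by (simp add: times_fg_def free_group_def Abs_fg_inverse reduced_reduce)

lemma Rep_fg_one: "Rep_fg 1 = \<one>\<^bsub>free_group X\<^esub>"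
  by (simp add: one_fg_def free_group_def Abs_fg_inverse reduced_def)

lemma Rep_fg_minv: "Rep_fg (minv u) = inv\<^bsub>free_group UNIV\<^esub> (Rep_fg u)"
  unfolding minv_fg_def
  by (rule Rep_fg_Abs[OF group.inv_closed[OF group_free_group Rep_fg_mem]])

instance
proof
  interpret F: group "free_group (UNIV :: 'a set)" by (rule group_free_group)
  fix a b c :: "'a fg"
  show "a * b * c = a * (b * c)" "1 * a = a" "a * 1 = a" "minv a * a = 1"
    by (simp_all add: Rep_fg_mult[of _ _ UNIV] Rep_fg_one[of UNIV] Rep_fg_minv Rep_fg_mem F.m_assoc
        flip: Rep_fg_inject)
qed

end

lemma Abs_fg_mult:
  assumes "u \<in> carrier (free_group X)" "v \<in> carrier (free_group X)"
  shows "Abs_fg (u \<otimes>\<^bsub>free_group X\<^esub> v) = Abs_fg u * Abs_fg v"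
  using Rep_fg_mult[of "Abs_fg u" "Abs_fg v" X] assms by (metis Rep_fg_Abs Rep_fg_inverse)

lemma Abs_fg_inv:
  assumes "u \<in> carrier (free_group X)"
  shows "Abs_fg (inv\<^bsub>free_group X\<^esub> u) = minv (Abs_fg u)"
proof -
  interpret group "free_group X" by (rule group_free_group)
  have "Abs_fg u * Abs_fg (inv\<^bsub>free_group X\<^esub> u) = 1"
    using assms Abs_fg_mult[of u X "inv\<^bsub>free_group X\<^esub> u"] Rep_fg_one[of X]
    by (metis Rep_fg_inverse inv_closed r_inv)
  then show ?thesis
    by (metis minv_unique)
qed

definition gen :: "'a \<Rightarrow> 'a fg" where
  "gen x = Abs_fg (free_gen x)"

abbreviation word :: "'a word \<Rightarrow> 'a fg" where
  "word \<equiv> word_lift gen"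

lemma Rep_fg_letter: "Rep_fg (letter gen p) = [p]"
proof -
  obtain x b where p: "p = (x, b)" by (cases p)
  have "Abs_fg [(x, False)] * Abs_fg [(x, True)] = 1"
    by (simp add: times_fg_def one_fg_def Abs_fg_inverse reduced_def reduce_def cancels_def)
  then have "minv (Abs_fg [(x, True)]) = Abs_fg [(x, False)]"
    by (metis minv_minv minv_unique)
  then show ?thesis
    by (simp add: p letter_def gen_def free_gen_def Abs_fg_inverse reduced_def)
qed

lemma Rep_fg_word: "Rep_fg (word w) = reduce w"
proof (induction w)
  case (Cons p w)
  then have "Rep_fg (word (p # w)) = reduce (p # reduce w)"
    by (simp add: Rep_fg_mult[of _ _ UNIV] Rep_fg_letter free_group_def)
  also have "\<dots> = push p (reduce w)"
    using reduce_id[OF reduced_reduce, of w] by (simp add: reduce_def)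
  finally show ?case
    by (simp add: reduce_def)
qed (simp add: Rep_fg_one[of UNIV] free_group_def reduce_def)

lemma word_Rep_fg: "word (Rep_fg g) = g"
  using Rep_fg[of g] by (metis Rep_fg_word Rep_fg_inject mem_Collect_eq reduce_id)

section \<open>From three generators to the standard generators and back\<close>

definition three_generator_relations :: "nat \<Rightarrow> 'g::group_mult \<Rightarrow> 'g \<Rightarrow> 'g \<Rightarrow> bool" where
  "three_generator_relations n a s x \<longleftrightarrow>
     (\<forall>i. 2 \<le> i \<and> 2 * i \<le> n \<longrightarrow> a * cnj (s ^ i) a = cnj (s ^ i) a * a) \<and>
     s ^ n = (s * a) ^ (n - 1) \<and>
     (\<forall>i. 2 \<le> i \<and> i + 2 \<le> n \<longrightarrow> x * cnj (s ^ i) a = cnj (s ^ i) a * x) \<and>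
     (\<forall>i. 2 \<le> i \<and> i + 2 \<le> n \<longrightarrow> x * cnj (s ^ i) x = cnj (s ^ i) x * x) \<and>
     x * cnj s x * a = cnj s a * x * cnj s x \<and>
     x * cnj s x * x = cnj s x * x * cnj s x \<and>
     x * x = 1"

text \<open>The relations are indexed by integers for the sake of the exponent \<open>- i\<close>;
  all indices are positive, so natural numbers serve from here on.\<close>

lemma all_int_ge_2_iff:
  "(\<forall>i::int. 2 \<le> i \<and> P i \<longrightarrow> Q i) \<longleftrightarrow> (\<forall>k::nat. 2 \<le> k \<and> P (int k) \<longrightarrow> Q (int k))"
proof (intro iffI allI impI)
  fix i :: int
  assume "\<forall>k::nat. 2 \<le> k \<and> P (int k) \<longrightarrow> Q (int k)" "2 \<le> i \<and> P i"
  then show "Q i"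
    by (auto dest: spec[of _ "nat i"])
qed auto

lemma free_gen_mem_UNIV: "free_gen x \<in> carrier (free_group UNIV)"
  by (rule free_gen_in_carrier) simp

lemma bp_relations_iff:
  "(\<forall>(u, v) \<in> bp_relations n. word_lift g u = word_lift g v) \<longleftrightarrow>
     three_generator_relations n (g Sigma_1) (g Sigma_prod) (g Xi_1)"
proof -
  note [simp] = word_lift_mult word_lift_nat_pow word_lift_int_pow[OF free_gen_mem_UNIV]
    word_lift_inv[OF free_gen_mem_UNIV] word_lift_one
  have ball_Collect: "(\<forall>p \<in> {f i | i. R i}. Q p) \<longleftrightarrow> (\<forall>i. R i \<longrightarrow> Q (f i))" for f :: "int \<Rightarrow> 'z" and R Q
    by blast
  have "(2 * int k \<le> int n) = (2 * k \<le> n)" "(int k \<le> int n - 2) = (k + 2 \<le> n)" for k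
    by auto
  then show ?thesis
    unfolding bp_relations_def Let_def ball_Un ball_Collect all_int_ge_2_iff three_generator_relations_def
    by (simp add: cnj_def mult.assoc power2_eq_square)
qed

text \<open>The Fenn-Rimanyi-Rourke relations in an arbitrary group. Distant commutation within one
  family is symmetric and stated for \<open>i + 1 < j\<close> only; between sigma and xi the two
  orders are separate conditions.\<close>

locale standard_relations =
  fixes n :: nat and sg xi :: "nat \<Rightarrow> 'g::group_mult"
  assumes n_ge_3: "n \<ge> 3"
    and xi_sq: "\<And>i. 1 \<le> i \<Longrightarrow> i < n \<Longrightarrow> xi i * xi i = 1"
    and xi_far: "\<And>i j. 1 \<le> i \<Longrightarrow> i < n \<Longrightarrow> 1 \<le> j \<Longrightarrow> j < n \<Longrightarrow> i + 1 < j \<Longrightarrow> xi i * xi j = xi j * xi i"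
    and xi_braid: "\<And>i. 1 \<le> i \<Longrightarrow> i + 1 < n \<Longrightarrow> xi i * xi (i + 1) * xi i = xi (i + 1) * xi i * xi (i + 1)"
    and sg_far: "\<And>i j. 1 \<le> i \<Longrightarrow> i < n \<Longrightarrow> 1 \<le> j \<Longrightarrow> j < n \<Longrightarrow> i + 1 < j \<Longrightarrow> sg i * sg j = sg j * sg i"
    and sg_braid: "\<And>i. 1 \<le> i \<Longrightarrow> i + 1 < n \<Longrightarrow> sg i * sg (i + 1) * sg i = sg (i + 1) * sg i * sg (i + 1)"
    and sg_xi_far: "\<And>i j. 1 \<le> i \<Longrightarrow> i < n \<Longrightarrow> 1 \<le> j \<Longrightarrow> j < n \<Longrightarrow> i + 1 < j \<or> j + 1 < i \<Longrightarrow>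
      sg i * xi j = xi j * sg i"
    and xi_xi_sg: "\<And>i. 1 \<le> i \<Longrightarrow> i + 1 < n \<Longrightarrow> xi i * xi (i + 1) * sg i = sg (i + 1) * xi i * xi (i + 1)"
    and sg_sg_xi: "\<And>i. 1 \<le> i \<Longrightarrow> i + 1 < n \<Longrightarrow> sg i * sg (i + 1) * xi i = xi (i + 1) * sg i * sg (i + 1)"

text \<open>The base point \<^term>\<open>cnj (minv s) a\<close> makes \<^term>\<open>conj_seq s a 1\<close> equal to \<open>a\<close>, matching the
  indexing of the standard generators from 1.\<close>

definition conj_seq :: "'g::group_mult \<Rightarrow> 'g \<Rightarrow> nat \<Rightarrow> 'g" where
  "conj_seq s a k = cnj (s ^ k) (cnj (minv s) a)"

lemma conj_seq_one [simp]: "conj_seq s a (Suc 0) = a"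
  by (simp add: conj_seq_def cnj_def mult.assoc)

lemma cnj_conj_seq: "cnj (s ^ i) (conj_seq s a k) = conj_seq s a (i + k)"
  by (simp add: conj_seq_def cnj_cnj power_add mult.assoc)

lemma cnj_conj_seq_1: "cnj s (conj_seq s a k) = conj_seq s a (Suc k)"
  using cnj_conj_seq[of s 1] by simp

lemma conj_seq_Suc: "conj_seq s a (Suc i) = cnj (s ^ i) a"
  using cnj_conj_seq[of s i a 1] by simp

text \<open>Push every \<open>s\<close> to the right: the k-th factor \<open>a\<close> has
  \<open>s ^ k\<close> on its left and becomes entry k + 1, so the indices run from 2 to m +
  1.\<close>

lemma power_mult_conj_seq:
  "(s * a) ^ m = prod_list (map (conj_seq s a) [2..<m + 2]) * s ^ m"
proof (induction m)
  case (Suc m)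
  have "s ^ Suc m * a = conj_seq s a (Suc (Suc m)) * s ^ Suc m"
    by (simp add: conj_seq_Suc cnj_def group_norm)
  then have "(s * a) ^ Suc m = prod_list (map (conj_seq s a) [2..<m + 2]) * (conj_seq s a (m + 2) * s ^ Suc m)"
    by (simp only: power_Suc2 Suc.IH mult.assoc) (simp add: power_Suc2 mult.assoc)
  then show ?case
    by (simp add: mult.assoc)
qed simp

lemma cnj_prod_conj_seq:
  "cnj s (prod_list (map (conj_seq s a) [i..<j])) = prod_list (map (conj_seq s a) [Suc i..<Suc j])"
proof -
  have "cnj s \<circ> conj_seq s a = conj_seq s a \<circ> Suc"
    by (simp add: fun_eq_iff cnj_conj_seq_1)
  then show ?thesis
    by (simp only: cnj_prod_list map_map flip: map_Suc_upt)
qed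

lemma cnj_eqD: "cnj g a = b \<Longrightarrow> g * a = b * g"
  by (auto simp: cnj_def mult.assoc)

text \<open>The single relation for \<open>s ^ n\<close> yields both its centrality and the formula
  for \<open>s\<close> as a product. Each standard relation is then proved for the lowest index and
  shifted by conjugation with a power of \<open>s\<close>.\<close>

lemma standard_relations_if_three:
  assumes n: "n \<ge> 3" and rel: "three_generator_relations n a s x"
  shows "standard_relations n (conj_seq s a) (conj_seq s x)"
    and "s = prod_list (map (conj_seq s a) [1..<n])"
proof -
  let ?S = "conj_seq s a" and ?X = "conj_seq s x"
  have R1: "a * cnj (s ^ i) a = cnj (s ^ i) a * a" if "2 \<le> i" "2 * i \<le> n" for i
    using rel that by (simp add: three_generator_relations_def)
  have R2: "s ^ n = (s * a) ^ (n - 1)"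
    using rel by (simp add: three_generator_relations_def)
  have R3: "x * cnj (s ^ i) a = cnj (s ^ i) a * x" if "2 \<le> i" "i + 2 \<le> n" for i
    using rel that by (simp add: three_generator_relations_def)
  have R4: "x * cnj (s ^ i) x = cnj (s ^ i) x * x" if "2 \<le> i" "i + 2 \<le> n" for i
    using rel that by (simp add: three_generator_relations_def)
  have R5: "?X 1 * ?X 2 * ?S 1 = ?S 2 * ?X 1 * ?X 2" and R6: "?X 1 * ?X 2 * ?X 1 = ?X 2 * ?X 1 * ?X 2"
    and R7: "?X 1 * ?X 1 = 1"
    using rel cnj_conj_seq_1[of s _ 1] by (simp_all add: three_generator_relations_def numeral_2_eq_2)

  have "s ^ n * s = s * s ^ n"
    by (simp add: power_commutes)
  \<comment> \<open>The relation makes \<open>s ^ n\<close> a power of \<open>s * a\<close> as well,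
    so it commutes with \<open>s\<close>, with \<open>s * a\<close> and therefore with
    \<open>a\<close>.\<close>
  moreover have "s ^ n * (s * a) = (s * a) * s ^ n"
    unfolding R2 by (simp add: power_commutes)
  ultimately have "s * (s ^ n * a) = s * (a * s ^ n)"
    by (metis mult.assoc)
  then have center: "s ^ n * a = a * s ^ n"
    by (simp only: mult_left_cancel_group)

  \<comment> \<open>Cancelling \<open>s ^ (n - 1)\<close> leaves \<open>s\<close> as the product of
    the entries 2 to n, one index too high. Conjugation by \<open>s\<close> fixes \<open>s\<close>,
    so the shift can be undone.\<close>
  have "s ^ n = prod_list (map ?S [2..<n + 1]) * s ^ (n - 1)"
    using power_mult_conj_seq[of s a "n - 1"] n by (simp add: R2 Suc_diff_le numeral_2_eq_2)
  moreover have "s ^ n = s * s ^ (n - 1)"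
    using n by (simp flip: power_Suc)
  ultimately have "s = prod_list (map ?S [2..<n + 1])"
    by (metis mult_right_cancel_group)
  also have "\<dots> = cnj s (prod_list (map ?S [1..<n]))"
    by (simp add: cnj_prod_conj_seq numeral_2_eq_2)
  finally have "cnj s s = cnj s (prod_list (map ?S [1..<n]))"
    by (simp add: cnj_def mult.assoc)
  then show s: "s = prod_list (map ?S [1..<n])"
    by (simp only: cnj_eq_iff)

  have cs: "cnj (s ^ i) (?S k) = ?S (i + k)" "cnj (s ^ i) (?X k) = ?X (i + k)" for i k
    by (rule cnj_conj_seq)+
  have conj_rel: "cnj (s ^ (i - 1)) (?S 1) = ?S i" "cnj (s ^ (i - 1)) (?X 1) = ?X i"
    "cnj (s ^ (i - 1)) (?S 2) = ?S (i + 1)" "cnj (s ^ (i - 1)) (?X 2) = ?X (i + 1)" if "1 \<le> i" for i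
    using that unfolding cs by simp_all

  have S1_far: "a * ?S (Suc i) = ?S (Suc i) * a" if "2 \<le> i" "i + 2 \<le> n" for i
  proof (cases "2 * i \<le> n")
    case False
    \<comment> \<open>Beyond n/2, take the relation for n - i and conjugate it by
      \<open>s ^ i\<close>: because \<open>s ^ n\<close> commutes with \<open>a\<close>, the result
      is the relation for i.\<close>
    then have "a * cnj (s ^ (n - i)) a = cnj (s ^ (n - i)) a * a"
      using that by (intro R1) auto
    then have "cnj (s ^ i) (a * cnj (s ^ (n - i)) a) = cnj (s ^ i) (cnj (s ^ (n - i)) a * a)"
      by simp
    moreover have "cnj (s ^ i * s ^ (n - i)) a = a"
      using that center by (simp add: cnj_commute flip: power_add)
    ultimately show ?thesis
      by (simp add: cnj_mult cnj_cnj conj_seq_Suc)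
  qed (use R1 that in \<open>simp add: conj_seq_Suc\<close>)
  have S1_X_far: "a * ?X (Suc i) = ?X (Suc i) * a" if "2 \<le> i" "i + 2 \<le> n" for i
  proof -
    \<comment> \<open>Given is xi_1 against the later sigma; reflecting i to n - i in the same way
      turns this into sigma_1 against the later xi.\<close>
    have "x * cnj (s ^ (n - i)) a = cnj (s ^ (n - i)) a * x"
      using that by (intro R3) auto
    then have "cnj (s ^ i) (x * cnj (s ^ (n - i)) a) = cnj (s ^ i) (cnj (s ^ (n - i)) a * x)"
      by simp
    moreover have "cnj (s ^ i * s ^ (n - i)) a = a"
      using that center by (simp add: cnj_commute flip: power_add)
    ultimately show ?thesis
      by (simp add: cnj_mult cnj_cnj conj_seq_Suc)
  qed
  have far: "conj_seq s b i * conj_seq s c j = conj_seq s c j * conj_seq s b i"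
    if *: "\<And>k. 2 \<le> k \<Longrightarrow> k + 2 \<le> n \<Longrightarrow> b * conj_seq s c (Suc k) = conj_seq s c (Suc k) * b"
      and "1 \<le> i" "j < n" "i + 1 < j" for b c i j
  proof -
    have "cnj (s ^ (i - 1)) (conj_seq s b 1 * conj_seq s c (Suc (j - i))) =
        cnj (s ^ (i - 1)) (conj_seq s c (Suc (j - i)) * conj_seq s b 1)"
      using *[of "j - i"] that(2-) by simp
    then show ?thesis
      using that(2-) by (simp only: cnj_mult cnj_conj_seq) simp
  qed
  have S_far: "?S i * ?S j = ?S j * ?S i" if "1 \<le> i" "j < n" "i + 1 < j" for i j
    using far[of a a] S1_far that by blast
  have S_X_far: "?S i * ?X j = ?X j * ?S i" if "1 \<le> i" "j < n" "i + 1 < j" for i j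
    using far[of a x] S1_X_far that by blast
  have X_S_far: "?X i * ?S j = ?S j * ?X i" if "1 \<le> i" "j < n" "i + 1 < j" for i j
    using far[of x a] R3 that unfolding conj_seq_Suc by blast
  have X_far: "?X i * ?X j = ?X j * ?X i" if "1 \<le> i" "j < n" "i + 1 < j" for i j
    using far[of x x] R4 that unfolding conj_seq_Suc by blast

  \<comment> \<open>The two relations that start with sigma_1 sigma_2 are hidden in
    \<open>s * ?S 1 = ?S 2 * s\<close> and \<open>s * ?X 1 = ?X 2 * s\<close>: the tail
    \<open>r\<close> of \<open>s\<close> commutes with \<open>?S 1\<close> and \<open>?X 1\<close>
    and cancels.\<close>
  define r where "r = prod_list (map ?S [3..<n])"
  have s_eq: "s = ?S 1 * ?S 2 * r"
    using n by (subst s) (simp add: r_def upt_conv_Cons mult.assoc numeral_2_eq_2 numeral_3_eq_3)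
  have r_S: "r * ?S 1 = ?S 1 * r" and r_X: "r * ?X 1 = ?X 1 * r"
    unfolding r_def using S_far[of 1] X_S_far[of 1]
    by (intro commute_prod_list; force)+
  have "s * ?S 1 = ?S 2 * s" "s * ?X 1 = ?X 2 * s"
    using cnj_eqD[OF cnj_conj_seq_1[of s a 1]] cnj_eqD[OF cnj_conj_seq_1[of s x 1]]
    unfolding Suc_1 by blast+
  then have "?S 1 * ?S 2 * r * ?S 1 = ?S 2 * (?S 1 * ?S 2 * r)" "?S 1 * ?S 2 * r * ?X 1 = ?X 2 * (?S 1 * ?S 2 * r)"
    by (simp_all only: flip: s_eq)
  then have "?S 1 * ?S 2 * ?S 1 * r = ?S 2 * ?S 1 * ?S 2 * r" "?S 1 * ?S 2 * ?X 1 * r = ?X 2 * ?S 1 * ?S 2 * r"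
    by (simp_all only: mult.assoc r_S r_X)
  then have S_braid: "?S 1 * ?S 2 * ?S 1 = ?S 2 * ?S 1 * ?S 2" and SSX: "?S 1 * ?S 2 * ?X 1 = ?X 2 * ?S 1 * ?S 2"
    by (simp_all only: mult_right_cancel_group)

  show "standard_relations n ?S ?X"
  proof
    fix i :: nat
    assume i: "1 \<le> i"
    have c: "cnj (s ^ (i - 1)) u = cnj (s ^ (i - 1)) v" if "u = v" for u v
      using that by simp
    show "?X i * ?X i = 1"
      using c[OF R7] by (simp only: cnj_mult conj_rel[OF i] cnj_one)
    show "?X i * ?X (i + 1) * ?X i = ?X (i + 1) * ?X i * ?X (i + 1)"
      using c[OF R6] by (simp only: cnj_mult conj_rel[OF i])
    show "?S i * ?S (i + 1) * ?S i = ?S (i + 1) * ?S i * ?S (i + 1)"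
      using c[OF S_braid] by (simp only: cnj_mult conj_rel[OF i])
    show "?X i * ?X (i + 1) * ?S i = ?S (i + 1) * ?X i * ?X (i + 1)"
      using c[OF R5] by (simp only: cnj_mult conj_rel[OF i])
    show "?S i * ?S (i + 1) * ?X i = ?X (i + 1) * ?S i * ?S (i + 1)"
      using c[OF SSX] by (simp only: cnj_mult conj_rel[OF i])
    fix j :: nat
    assume j: "i < n" "1 \<le> j" "j < n"
    show "?S i * ?X j = ?X j * ?S i" if "i + 1 < j \<or> j + 1 < i"
      using that S_X_far[of i j] X_S_far[of j i] i j by (elim disjE) simp_all
    assume "i + 1 < j"
    then show "?X i * ?X j = ?X j * ?X i" "?S i * ?S j = ?S j * ?S i"
      using X_far[of i j] S_far[of i j] i j by simp_all
  qed (rule n)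
qed

section \<open>From the standard relations back to three generators\<close>

context standard_relations
begin

definition sigma_prod :: 'g where
  "sigma_prod = prod_list (map sg [1..<n])"

lemma sg_far_sym:
  assumes "1 \<le> i" "i < n" "1 \<le> j" "j < n" "i + 1 < j \<or> j + 1 < i"
  shows "sg i * sg j = sg j * sg i"
  using assms sg_far[of i j] sg_far[of j i] by auto

text \<open>Only the factors with indices i and i + 1 matter: the later ones commute with sigma_i
  and xi_i, the earlier ones with sigma_(i+1) and xi_(i+1), and the middle pair shifts the index by
  \<open>sg_braid\<close> and \<open>sg_sg_xi\<close>.\<close>

lemma cnj_sigma_prod:
  assumes i: "1 \<le> i" "i + 1 < n"
  shows "cnj sigma_prod (sg i) = sg (i + 1)" "cnj sigma_prod (xi i) = xi (i + 1)"
proof -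
  let ?A = "prod_list (map sg [1..<i])" and ?B = "prod_list (map sg [i + 2..<n])"
  have "[1..<n] = [1..<i] @ i # (i + 1) # [i + 2..<n]"
    using i upt_add_eq_append[of 1 i "n - i"] by (simp add: upt_conv_Cons)
  then have s: "sigma_prod = ?A * (sg i * sg (i + 1) * ?B)"
    by (simp only: sigma_prod_def map_append list.map prod_list.append prod_list.Cons mult.assoc)
  have B: "?B * sg i = sg i * ?B" "?B * xi i = xi i * ?B"
    using i by (intro commute_prod_list; auto simp: sg_far_sym sg_xi_far)+
  have A: "?A * sg (i + 1) = sg (i + 1) * ?A" "?A * xi (i + 1) = xi (i + 1) * ?A"
    using i by (intro commute_prod_list; auto simp: sg_far_sym sg_xi_far)+
  have "sigma_prod * sg i = ?A * (sg i * sg (i + 1) * (?B * sg i))"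
    by (simp only: s mult.assoc)
  also have "\<dots> = ?A * (sg i * sg (i + 1) * sg i * ?B)"
    by (simp only: B mult.assoc)
  also have "\<dots> = (?A * sg (i + 1)) * (sg i * sg (i + 1) * ?B)"
    unfolding sg_braid[OF i] by (simp only: mult.assoc)
  also have "\<dots> = sg (i + 1) * sigma_prod"
    by (simp only: A s mult.assoc)
  finally show "cnj sigma_prod (sg i) = sg (i + 1)"
    by (simp add: cnj_def mult.assoc)
  have "sigma_prod * xi i = ?A * (sg i * sg (i + 1) * (?B * xi i))"
    by (simp only: s mult.assoc)
  also have "\<dots> = ?A * (sg i * sg (i + 1) * xi i * ?B)"
    by (simp only: B mult.assoc)
  also have "\<dots> = (?A * xi (i + 1)) * (sg i * sg (i + 1) * ?B)"
    unfolding sg_sg_xi[OF i] by (simp only: mult.assoc)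
  also have "\<dots> = xi (i + 1) * sigma_prod"
    by (simp only: A s mult.assoc)
  finally show "cnj sigma_prod (xi i) = xi (i + 1)"
    by (simp add: cnj_def mult.assoc)
qed

lemma cnj_sigma_prod_power:
  assumes "i + 1 < n"
  shows "cnj (sigma_prod ^ i) (sg 1) = sg (Suc i)" "cnj (sigma_prod ^ i) (xi 1) = xi (Suc i)"
proof -
  have "cnj (sigma_prod ^ i) (sg 1) = sg (Suc i) \<and> cnj (sigma_prod ^ i) (xi 1) = xi (Suc i)"
    using assms
  proof (induction i)
    case 0
    then show ?case by (simp add: cnj_def)
  next
    case (Suc i)
    then show ?case
      using cnj_sigma_prod[of "Suc i"] by (simp flip: cnj_cnj)
  qed
  then show "cnj (sigma_prod ^ i) (sg 1) = sg (Suc i)" "cnj (sigma_prod ^ i) (xi 1) = xi (Suc i)"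
    by blast+
qed

lemma three_relations: "three_generator_relations n (sg 1) sigma_prod (xi 1)"
proof -
  have sg: "conj_seq sigma_prod (sg 1) k = sg k" if "1 \<le> k" "k < n" for k
    using that cnj_sigma_prod_power(1)[of "k - 1"] conj_seq_Suc[of sigma_prod "sg 1" "k - 1"] by simp
  have "(sigma_prod * sg 1) ^ (n - 1) =
      prod_list (map (conj_seq sigma_prod (sg 1)) [Suc 1..<Suc n]) * sigma_prod ^ (n - 1)"
    using n_ge_3 by (simp add: power_mult_conj_seq numeral_2_eq_2 Suc_diff_le)
  \<comment> \<open>The list reaches index n, where no standard generator exists; taking out one
    conjugation brings it back to 1, ..., n - 1.\<close>
  also have "prod_list (map (conj_seq sigma_prod (sg 1)) [Suc 1..<Suc n]) =
      cnj sigma_prod (prod_list (map (conj_seq sigma_prod (sg 1)) [1..<n]))"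
    by (simp only: cnj_prod_conj_seq)
  also have "map (conj_seq sigma_prod (sg 1)) [1..<n] = map sg [1..<n]"
    using sg by simp
  also have "cnj sigma_prod (prod_list (map sg [1..<n])) = sigma_prod"
    unfolding sigma_prod_def[symmetric] by (simp add: cnj_def mult.assoc)
  also have "sigma_prod * sigma_prod ^ (n - 1) = sigma_prod ^ n"
    using n_ge_3 by (simp flip: power_Suc)
  finally have R2: "sigma_prod ^ n = (sigma_prod * sg 1) ^ (n - 1)"
    by simp
  have 1: "cnj sigma_prod (sg 1) = sg 2" "cnj sigma_prod (xi 1) = xi 2"
    using cnj_sigma_prod[of 1] n_ge_3 by (simp_all add: numeral_2_eq_2)
  have 2: "cnj (sigma_prod ^ i) (sg 1) = sg (Suc i)" "cnj (sigma_prod ^ i) (xi 1) = xi (Suc i)"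
    if "i + 2 \<le> n" for i
    using that by (intro cnj_sigma_prod_power; simp)+
  have 3: "i + 2 \<le> n" if "2 \<le> i" "2 * i \<le> n" for i
    using that by linarith
  show ?thesis
    unfolding three_generator_relations_def 1
  proof (intro conjI allI impI; (elim conjE)?)
    fix i :: nat
    assume i: "2 \<le> i"
    show "sg 1 * cnj (sigma_prod ^ i) (sg 1) = cnj (sigma_prod ^ i) (sg 1) * sg 1" if "2 * i \<le> n"
      using sg_far[of 1 "Suc i"] i 3[OF i that] by (simp add: 2 del: One_nat_def)
    assume "i + 2 \<le> n"
    then show "xi 1 * cnj (sigma_prod ^ i) (sg 1) = cnj (sigma_prod ^ i) (sg 1) * xi 1"
      "xi 1 * cnj (sigma_prod ^ i) (xi 1) = cnj (sigma_prod ^ i) (xi 1) * xi 1"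
      using sg_xi_far[of "Suc i" 1] xi_far[of 1 "Suc i"] i by (simp_all add: 2 del: One_nat_def)
  qed (use n_ge_3 R2 xi_xi_sg[of 1] xi_braid[of 1] xi_sq[of 1] in \<open>simp_all add: numeral_2_eq_2\<close>)
qed

end

section \<open>Confluent rewriting with values in a group\<close>

text \<open>A version of Newman's lemma: the hypothesis \<open>confl\<close> asks that two descending moves at \<open>t\<close> can be
  joined by moves staying below \<open>t\<close>, in the form that any function \<open>\<theta>\<close> compatible with these lower
  moves assigns the same value to \<open>t\<close> along both.\<close>

lemma confluent_potential:
  fixes act :: "'a \<Rightarrow> 't \<Rightarrow> 't" and e :: "'a \<Rightarrow> 'g::group_mult" and mu :: "'t \<Rightarrow> nat"
  assumes closed: "\<And>a t. a \<in> A \<Longrightarrow> t \<in> T \<Longrightarrow> act a t \<in> T"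
    and bar: "\<And>a. a \<in> A \<Longrightarrow> bar a \<in> A" "\<And>a. a \<in> A \<Longrightarrow> e (bar a) = minv (e a)"
      "\<And>a t. a \<in> A \<Longrightarrow> t \<in> T \<Longrightarrow> act (bar a) (act a t) = t"
    and strict: "\<And>a t. a \<in> A \<Longrightarrow> t \<in> T \<Longrightarrow> mu (act a t) \<noteq> mu t"
    and confl: "\<And>\<theta> a b t. \<lbrakk>a \<in> A; b \<in> A; t \<in> T; mu (act a t) < mu t; mu (act b t) < mu t;
        \<And>c s. \<lbrakk>c \<in> A; s \<in> T; mu s < mu t; mu (act c s) < mu t\<rbrakk> \<Longrightarrow> \<theta> (act c s) = e c * \<theta> s\<rbrakk> \<Longrightarrow>
        minv (e a) * \<theta> (act a t) = minv (e b) * \<theta> (act b t)"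
  shows "\<exists>\<theta>. (\<forall>a\<in>A. \<forall>t\<in>T. \<theta> (act a t) = e a * \<theta> t) \<and>
      (\<forall>t\<in>T. (\<forall>a\<in>A. \<not> mu (act a t) < mu t) \<longrightarrow> \<theta> t = 1)"
proof -
  define down where "down t a \<longleftrightarrow> a \<in> A \<and> mu (act a t) < mu t" for t a
  \<comment> \<open>Descend along arbitrarily chosen moves; an element without a descending move
    gets the value 1.\<close>
  define \<theta> where "\<theta> = wfrec (measure mu) (\<lambda>\<theta> t. if \<exists>a. down t a
    then minv (e (SOME a. down t a)) * \<theta> (act (SOME a. down t a) t) else 1)"
  have \<theta>_some: "\<theta> t = minv (e (SOME a. down t a)) * \<theta> (act (SOME a. down t a) t)"
    if "\<exists>a. down t a" for t
  proof -
    have "mu (act (SOME a. down t a) t) < mu t"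
      using someI_ex[OF that] by (simp add: down_def)
    then show ?thesis
      using that by (subst def_wfrec[OF \<theta>_def[THEN eq_reflection]]) (simp_all add: cut_apply)
  qed
  have \<theta>_none: "\<theta> t = 1" if "\<not> (\<exists>a. down t a)" for t
    using that by (subst def_wfrec[OF \<theta>_def[THEN eq_reflection]]) auto
  have descend: "\<theta> (act a t) = e a * \<theta> t" if "down t a" "t \<in> T" for a t
    using that
  proof (induction "mu t" arbitrary: a t rule: less_induct)
    case less
    let ?b = "SOME a. down t a"
    have b: "down t ?b"
      using less.prems by (intro someI_ex[of "down t"]) blast
    have "minv (e a) * \<theta> (act a t) = minv (e ?b) * \<theta> (act ?b t)"
    proof (rule confl)
      fix c s
      assume c: "c \<in> A" and s: "s \<in> T" and lt: "mu s < mu t" "mu (act c s) < mu t"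
      show "\<theta> (act c s) = e c * \<theta> s"
      proof (cases "mu (act c s) < mu s")
        case True
        then show ?thesis
          using less.hyps[of s c] lt c s by (simp add: down_def)
      next
        case False
        \<comment> \<open>\<open>strict\<close> excludes level moves, so the reverse of
          \<open>c\<close> descends from \<open>act c s\<close>, which is still below
          \<open>t\<close>; the induction hypothesis applies to it.\<close>
        then have "down (act c s) (bar c)"
          using strict[OF c s] bar c s by (simp add: down_def)
        then show ?thesis
          using less.hyps[of "act c s" "bar c"] lt c s closed bar by simp
      qed
    qed (use b less.prems in \<open>simp_all add: down_def\<close>)
    also have "\<dots> = \<theta> t"
      using less.prems by (subst \<theta>_some[of t]) auto
    finally show ?case
      by (simp add: minv_mult_eq_iff)
  qed
  have "\<theta> (act a t) = e a * \<theta> t" if a: "a \<in> A" and t: "t \<in> T" for a t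
  proof (cases "mu (act a t) < mu t")
    case False
    then have "down (act a t) (bar a)"
      using strict[OF a t] bar a t by (simp add: down_def)
    then show ?thesis
      using descend[of "act a t" "bar a"] a t closed bar by simp
  qed (use descend a t in \<open>simp add: down_def\<close>)
  then show ?thesis
    using \<theta>_none by (intro exI[of _ \<theta>]) (auto simp: down_def)
qed


section \<open>The symmetric group inside a group with the standard relations\<close>

abbreviation adj :: "nat \<Rightarrow> nat \<Rightarrow> nat" where
  "adj k \<equiv> transpose k (Suc k)"

lemma adj_permutes: "1 \<le> k \<Longrightarrow> k < n \<Longrightarrow> adj k permutes {1..n}"
  by (rule permutes_swap_id) auto

text \<open>Unlike the number of inversions, this weight changes under a swap by an explicit amount.\<close>

definition perm_weight :: "nat \<Rightarrow> (nat \<Rightarrow> nat) \<Rightarrow> nat" where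
  "perm_weight n p = (\<Sum>i = 1..n. (n - i) * p i)"

lemma perm_weight_adj:
  assumes "1 \<le> k" "k < n"
  shows "perm_weight n (p \<circ> adj k) + p k = perm_weight n p + p (Suc k)"
proof -
  let ?R = "{1..n} - {k} - {Suc k}"
  have split: "(\<Sum>i = 1..n. f i) = f k + (f (Suc k) + (\<Sum>i\<in>?R. f i))" for f :: "nat \<Rightarrow> nat"
    using assms by (subst sum.remove[of _ k], simp, simp) (subst sum.remove[of _ "Suc k"], auto)
  have "(\<Sum>i\<in>?R. (n - i) * (p \<circ> adj k) i) = (\<Sum>i\<in>?R. (n - i) * p i)"
    by (rule sum.cong) auto
  moreover have "n - k = Suc (n - Suc k)"
    using assms by simp
  ultimately show ?thesis
    unfolding perm_weight_def split by (simp add: algebra_simps)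
qed

lemma perm_weight_less_iff:
  assumes "1 \<le> k" "k < n"
  shows "perm_weight n (p \<circ> adj k) < perm_weight n p \<longleftrightarrow> p (Suc k) < p k"
  using perm_weight_adj[OF assms, of p] by linarith

lemma permutes_ascending_id:
  assumes p: "p permutes {1..n::nat}" and asc: "\<And>k. 1 \<le> k \<Longrightarrow> k < n \<Longrightarrow> p k < p (Suc k)"
  shows "p = id"
proof (rule permutes_natset_ge[OF p], rule ballI)
  fix i
  assume "i \<in> {1..n}"
  then have "1 \<le> i" "i \<le> n" by auto
  then show "i \<le> p i"
  proof (induction i rule: dec_induct)
    case base
    then show ?case
      using permutes_in_image[OF p, of 1] by auto
  next
    case (step k)
    then show ?case
      using asc[of k] by auto
  qed
qed

text \<open>Sorting read backwards: every swap on the way up from the identity is made at an ascent.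
  In \<open>theta_fix_commute\<close> this rules out swaps at 1 and 2.\<close>

lemma perm_ascent_induct [consumes 1, case_names id adj]:
  assumes "p permutes {1..n}" and id: "P id"
    and adj: "\<And>p k. p permutes {1..n} \<Longrightarrow> 1 \<le> k \<Longrightarrow> k < n \<Longrightarrow> p k < p (Suc k) \<Longrightarrow> P p \<Longrightarrow> P (p \<circ> adj k)"
  shows "P p"
  using assms(1)
proof (induction "perm_weight n p" arbitrary: p rule: less_induct)
  case less
  show ?case
  proof (cases "\<exists>k. 1 \<le> k \<and> k < n \<and> p (Suc k) < p k")
    case True
    then obtain k where k: "1 \<le> k" "k < n" "p (Suc k) < p k"
      by blast
    have *: "(p \<circ> adj k) permutes {1..n}"
      using permutes_compose[OF adj_permutes[OF k(1,2)] less.prems] .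
    then have "P (p \<circ> adj k \<circ> adj k)"
      using less.hyps[of "p \<circ> adj k"] k * by (intro adj[of "p \<circ> adj k" k]) (simp_all add: perm_weight_less_iff)
    then show ?thesis
      by (simp add: comp_assoc)
  next
    case False
    have "p k < p (Suc k)" if "1 \<le> k" "k < n" for k
      using False that permutes_inj[OF less.prems] by (metis inj_eq linorder_neqE_nat n_not_Suc_n)
    then show ?thesis
      using permutes_ascending_id[OF less.prems] id by blast
  qed
qed

text \<open>Distinct indices can be renamed 1, 2, ..., so identities between the elements a_ij have
  to be checked for the smallest indices only.\<close>

lemma ex_permutes_list:
  assumes "distinct xs" "set xs \<subseteq> {1..n}"
  shows "\<exists>p. p permutes {1..n} \<and> (\<forall>m < length xs. p (xs ! m) = Suc m)"
  using assms
proof (induction xs rule: rev_induct)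
  case Nil
  show ?case
    by (intro exI[of _ id] conjI permutes_id) simp
next
  case (snoc x xs)
  then obtain p where p: "p permutes {1..n}" "\<And>m. m < length xs \<Longrightarrow> p (xs ! m) = Suc m"
    by auto
  have len: "length xs < n"
    using card_mono[OF _ snoc.prems(2)] distinct_card[OF snoc.prems(1)] by simp
  have px: "p x \<in> {1..n}"
    using snoc.prems permutes_in_image[OF p(1)] by simp
  have far: "p x \<noteq> Suc m" if "m < length xs" for m
    using p(2)[OF that] permutes_inj[OF p(1)] snoc.prems(1) that by (metis distinct_append inj_eq
        nth_mem not_distinct_conv_prefix)
  let ?q = "transpose (Suc (length xs)) (p x) \<circ> p"
  have "?q permutes {1..n}"
    using px len by (intro permutes_compose[OF p(1)] permutes_swap_id) auto
  moreover have "?q ((xs @ [x]) ! m) = Suc m" if "m < length (xs @ [x])" for m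
    using that far[of m] p(2)[of m] by (cases "m = length xs") (auto simp: nth_append)
  ultimately show ?case
    by blast
qed

context standard_relations
begin

lemma minv_xi: "1 \<le> k \<Longrightarrow> k < n \<Longrightarrow> minv (xi k) = xi k"
  by (rule minv_unique) (rule xi_sq)

text \<open>The xi_k satisfy Coxeter's relations, which present the symmetric group: two descents of
  \<open>p\<close> close up to the square of a commutation or the hexagon of a braid relation, with
  all other vertices of smaller weight.\<close>

lemma ex_theta:
  "\<exists>\<theta>. (\<forall>k p. 1 \<le> k \<and> k < n \<and> p permutes {1..n} \<longrightarrow> \<theta> (p \<circ> adj k) = xi k * \<theta> p) \<and> \<theta> id = 1"
proof -
  have closed: "p \<circ> adj k permutes {1..n}" if "p permutes {1..n}" "1 \<le> k" "k < n" for k p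
    using that by (intro permutes_compose adj_permutes)
  have "\<exists>\<theta>. (\<forall>k\<in>{1..<n}. \<forall>p\<in>{p. p permutes {1..n}}. \<theta> (p \<circ> adj k) = xi k * \<theta> p) \<and>
      (\<forall>p\<in>{p. p permutes {1..n}}. (\<forall>k\<in>{1..<n}. \<not> perm_weight n (p \<circ> adj k) < perm_weight n p) \<longrightarrow> \<theta> p = 1)"
  proof (rule confluent_potential[where bar = "\<lambda>k. k"])
    fix k p
    assume "k \<in> {1..<n}" "p \<in> {p. p permutes {1..n}}"
    then show "perm_weight n (p \<circ> adj k) \<noteq> perm_weight n p"
      using perm_weight_adj[of k n p] permutes_inj[of p "{1..n}"] by (auto simp: inj_eq)
  next
    fix \<theta> k l p
    assume "k \<in> {1..<n}" "l \<in> {1..<n}" and p: "p \<in> {p. p permutes {1..n}}"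
      and "perm_weight n (p \<circ> adj k) < perm_weight n p" "perm_weight n (p \<circ> adj l) < perm_weight n p"
      and "\<And>c s. \<lbrakk>c \<in> {1..<n}; s \<in> {p. p permutes {1..n}}; perm_weight n s < perm_weight n p;
        perm_weight n (s \<circ> adj c) < perm_weight n p\<rbrakk> \<Longrightarrow> \<theta> (s \<circ> adj c) = xi c * \<theta> s"
    then show "minv (xi k) * \<theta> (p \<circ> adj k) = minv (xi l) * \<theta> (p \<circ> adj l)"
    proof (induction k l rule: linorder_wlog)
      case (le k l)
      note \<theta> = le.prems(6)
      have k: "1 \<le> k" "k < n" and l: "1 \<le> l" "l < n" and p: "p permutes {1..n}"
        using le.prems by auto
      have pk: "p (Suc k) < p k" and pl: "p (Suc l) < p l"
        using le.prems(4,5) perm_weight_less_iff k l by blast+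
      note W = perm_weight_less_iff[OF k, THEN iffD2] perm_weight_less_iff[OF l, THEN iffD2]
      note less = W[THEN order.strict_trans]
      consider "k = l" | "l = Suc k" | "Suc k < l"
        using le.hyps by linarith
      then show ?case
      proof cases
        case 2
        \<comment> \<open>Here p k > p (k + 1) > p (k + 2), so every swap along either side of the
          hexagon lowers the weight.\<close>
        have w: "perm_weight n (p \<circ> adj k) < perm_weight n p" "perm_weight n (p \<circ> adj l) < perm_weight n p"
          "perm_weight n (p \<circ> adj k \<circ> adj l) < perm_weight n p" "perm_weight n (p \<circ> adj l \<circ> adj k) < perm_weight n p"
          "perm_weight n (p \<circ> adj k \<circ> adj l \<circ> adj k) < perm_weight n p"
          "perm_weight n (p \<circ> adj l \<circ> adj k \<circ> adj l) < perm_weight n p"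
          using perm_weight_adj[OF k, of p] perm_weight_adj[OF l, of "p \<circ> adj k"]
            perm_weight_adj[OF k, of "p \<circ> adj k \<circ> adj l"] perm_weight_adj[OF l, of p]
            perm_weight_adj[OF k, of "p \<circ> adj l"] perm_weight_adj[OF l, of "p \<circ> adj l \<circ> adj k"] pk pl
          unfolding 2 by simp_all
        have "\<theta> (p \<circ> adj k \<circ> adj l \<circ> adj k) = xi k * (xi l * \<theta> (p \<circ> adj k))"
          using k l p w by (subst \<theta>; simp add: closed del: One_nat_def)+
        moreover have "\<theta> (p \<circ> adj l \<circ> adj k \<circ> adj l) = xi l * (xi k * \<theta> (p \<circ> adj l))"
          using k l p w by (subst \<theta>; simp add: closed del: One_nat_def)+
        moreover have "adj k \<circ> adj l \<circ> adj k = adj l \<circ> adj k \<circ> adj l"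
          unfolding 2 by (auto simp: fun_eq_iff transpose_def)
        ultimately have "xi k * (xi l * \<theta> (p \<circ> adj k)) = xi l * (xi k * \<theta> (p \<circ> adj l))"
          by (simp add: comp_assoc)
        then have "xi k * xi l * xi k * (minv (xi k) * \<theta> (p \<circ> adj k)) =
            xi l * xi k * xi l * (minv (xi l) * \<theta> (p \<circ> adj l))"
          by (simp add: mult.assoc)
        moreover have "xi k * xi l * xi k = xi l * xi k * xi l"
          using xi_braid[of k] k l 2 by simp
        ultimately show ?thesis
          by (simp only: mult_left_cancel_group)
      next
        case 3
        have "\<theta> (p \<circ> adj k \<circ> adj l) = xi l * \<theta> (p \<circ> adj k)"
          using pk pl k l p 3 by (subst \<theta>) (simp_all add: closed less W del: One_nat_def)
        moreover have "\<theta> (p \<circ> adj l \<circ> adj k) = xi k * \<theta> (p \<circ> adj l)"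
          using pk pl k l p 3 by (subst \<theta>) (simp_all add: closed less W del: One_nat_def)
        moreover have "adj k \<circ> adj l = adj l \<circ> adj k"
          using 3 by (auto simp: fun_eq_iff transpose_def)
        ultimately have "xi l * xi k * (minv (xi k) * \<theta> (p \<circ> adj k)) =
            xi k * xi l * (minv (xi l) * \<theta> (p \<circ> adj l))"
          by (simp add: comp_assoc mult.assoc)
        moreover have "xi k * xi l = xi l * xi k"
          using xi_far[of k l] k l 3 by simp
        ultimately show ?thesis
          by (simp only: mult_left_cancel_group)
      qed simp
    next
      case (sym k l)
      then show ?case
        by (metis (no_types, lifting))
    qed
  qed (simp_all only: mem_Collect_eq atLeastLessThan_iff closed minv_xi comp_assoc transpose_comp_involutory comp_id)
  then obtain \<theta> where \<theta>: "\<forall>k\<in>{1..<n}. \<forall>p\<in>{p. p permutes {1..n}}. \<theta> (p \<circ> adj k) = xi k * \<theta> p"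
    "\<forall>p\<in>{p. p permutes {1..n}}. (\<forall>k\<in>{1..<n}. \<not> perm_weight n (p \<circ> adj k) < perm_weight n p) \<longrightarrow> \<theta> p = 1"
    by blast
  have "\<not> perm_weight n (id \<circ> adj k) < perm_weight n id" if "k \<in> {1..<n}" for k
    using that by (subst perm_weight_less_iff) auto
  then have "\<theta> id = 1"
    using \<theta>(2) permutes_id by blast
  then show ?thesis
    using \<theta>(1) by (intro exI[of _ \<theta>]) auto
qed

definition theta :: "(nat \<Rightarrow> nat) \<Rightarrow> 'g" where
  "theta = (SOME \<theta>. (\<forall>k p. 1 \<le> k \<and> k < n \<and> p permutes {1..n} \<longrightarrow> \<theta> (p \<circ> adj k) = xi k * \<theta> p) \<and> \<theta> id = 1)"

lemma theta_id: "theta id = 1"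
  and theta_comp_adj: "1 \<le> k \<Longrightarrow> k < n \<Longrightarrow> p permutes {1..n} \<Longrightarrow> theta (p \<circ> adj k) = xi k * theta p"
  using someI_ex[OF ex_theta] by (simp_all add: theta_def)

lemma theta_adj: "1 \<le> k \<Longrightarrow> k < n \<Longrightarrow> theta (adj k) = xi k"
  using theta_comp_adj[of k id] by (simp add: permutes_id theta_id)

text \<open>The order is reversed because \<open>theta p\<close> stands for the map
  \<open>y \<mapsto> y \<circ> p\<close> on tuples: in \<open>p \<circ> q\<close> the factor
  \<open>q\<close> acts last.\<close>

lemma theta_comp:
  assumes "q permutes {1..n}" "p permutes {1..n}"
  shows "theta (p \<circ> q) = theta q * theta p"
  using assms(1)
proof (induction q rule: perm_ascent_induct)
  case id
  show ?case by (simp only: comp_id theta_id mult_1_left)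
next
  case (adj q k)
  have "theta (p \<circ> q \<circ> adj k) = xi k * theta (p \<circ> q)"
    using adj assms by (intro theta_comp_adj permutes_compose)
  then show ?case
    using adj by (simp only: theta_comp_adj mult.assoc comp_assoc)
qed

end

section \<open>McCool's relations\<close>

context standard_relations
begin

text \<open>Such a permutation is a product of swaps at k > 2, and these xi_k commute with xi_1 and
  sigma_1. The last swap is made at an ascent: at 1 it would need p 1 = 2 and p 2 = 1, a descent; at
  2 it would need p 1 = 1 and p 3 = 2, which leaves no smaller value for p 2.\<close>

lemma theta_fix_commute:
  assumes "p permutes {1..n}" "p 1 = 1" "p 2 = 2"
  shows "theta p * (xi 1 * sg 1) = (xi 1 * sg 1) * theta p"
  using assms
proof (induction p rule: perm_ascent_induct)
  case id
  show ?case by (simp only: theta_id mult_1_left mult_1_right)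
next
  case (adj p k)
  have inj: "p i = p j \<longleftrightarrow> i = j" for i j
    using permutes_inj[OF adj.hyps(1)] by (simp add: inj_eq)
  have pos: "0 < p 1"
    using permutes_in_image[OF adj.hyps(1), of 1] n_ge_3 by auto
  consider "k = 1" | "k = 2" | "2 < k"
    using adj.hyps(2) by linarith
  then have k: "2 < k"
  proof cases
    case 1
    then show ?thesis
      using adj.hyps adj.prems by (simp add: numeral_2_eq_2)
  next
    case 2
    then have "p 1 = 1" "p 3 = 2"
      using adj.prems by (simp_all add: numeral_2_eq_2 numeral_3_eq_3)
    then have "p 2 < 2" "p 2 \<noteq> 1" "p 2 \<noteq> 0"
      using adj.hyps(4) 2 inj[of 2 1] permutes_in_image[OF adj.hyps(1), of 2] n_ge_3
      by (auto simp: numeral_3_eq_3)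
    then show ?thesis
      by simp
  qed
  have "xi k * (xi 1 * sg 1) = (xi 1 * sg 1) * xi k"
    using xi_far[of 1 k] sg_xi_far[of 1 k] k adj.hyps n_ge_3
    by (intro commute_mult[symmetric]) simp_all
  moreover have "theta p * (xi 1 * sg 1) = (xi 1 * sg 1) * theta p"
    using adj.prems k by (intro adj.IH) simp_all
  ultimately show ?case
    unfolding theta_comp_adj[OF adj.hyps(2,3,1)] by (intro commute_mult)
qed

text \<open>With xi_1 applied first, \<open>xi 1 * sg 1\<close> sends x_1 to x_2^-1 x_1 x_2 and
  fixes x_2, so it is a_12; a permutation taking i to 1 and j to 2 carries it to a_ij. Two such
  permutations differ by one that fixes 1 and 2, so the choice is immaterial.\<close>

definition mccool :: "nat \<Rightarrow> nat \<Rightarrow> 'g" where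
  "mccool i j = cnj (theta (SOME p. p permutes {1..n} \<and> p i = 1 \<and> p j = 2)) (xi 1 * sg 1)"

lemma mccool_eq:
  assumes p: "p permutes {1..n}" "p i = 1" "p j = 2"
  shows "mccool i j = cnj (theta p) (xi 1 * sg 1)"
proof -
  define q where "q = (SOME p. p permutes {1..n} \<and> p i = 1 \<and> p j = 2)"
  have q: "q permutes {1..n}" "q i = 1" "q j = 2"
    unfolding q_def using someI[of "\<lambda>p. p permutes {1..n} \<and> p i = 1 \<and> p j = 2" p] p by auto
  define r where "r = p \<circ> inv_into UNIV q"
  have inv_q: "inv_into UNIV q 1 = i" "inv_into UNIV q 2 = j" "inv_into UNIV q (q x) = x" for x
    using permutes_inverses[OF q(1)] q by metis+
  have r: "r permutes {1..n}" "r 1 = 1" "r 2 = 2"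
    using p inv_q permutes_compose[OF permutes_inv[OF q(1)] p(1)] by (simp_all add: r_def)
  have "p = r \<circ> q"
    using inv_q by (simp add: r_def fun_eq_iff)
  then have "theta p = theta q * theta r"
    using theta_comp[OF q(1) r(1)] by simp
  then have "cnj (theta p) (xi 1 * sg 1) = cnj (theta q) (xi 1 * sg 1)"
    using cnj_commute[OF theta_fix_commute[OF r]] by (simp flip: cnj_cnj)
  then show ?thesis
    by (simp add: mccool_def q_def)
qed

lemma cnj_theta_mccool:
  assumes p: "p permutes {1..n}" and ij: "i \<in> {1..n}" "j \<in> {1..n}" "i \<noteq> j"
  shows "cnj (theta p) (mccool (p i) (p j)) = mccool i j"
proof -
  have "distinct [p i, p j]" "set [p i, p j] \<subseteq> {1..n}"
    using ij permutes_in_image[OF p] permutes_inj[OF p] by (auto simp: inj_eq)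
  from ex_permutes_list[OF this] obtain q where q: "q permutes {1..n}" "\<forall>m < 2. q ([p i, p j] ! m) = Suc m"
    by auto
  have q12: "q (p i) = 1" "q (p j) = 2"
    using q(2)[rule_format, of 0] q(2)[rule_format, of 1] by auto
  have "mccool i j = cnj (theta (q \<circ> p)) (xi 1 * sg 1)"
    using q12 by (intro mccool_eq permutes_compose p q) simp_all
  then show ?thesis
    using mccool_eq[OF q(1) q12] theta_comp[OF p q(1)] by (simp add: cnj_cnj)
qed

lemma xi_mccool:
  assumes "1 \<le> k" "k < n" "i \<in> {1..n}" "j \<in> {1..n}" "i \<noteq> j"
  shows "xi k * mccool (adj k i) (adj k j) = mccool i j * xi k"
  using cnj_theta_mccool[OF adj_permutes[OF assms(1,2)] assms(3-5)] theta_adj[OF assms(1,2)]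
  by (intro cnj_eqD) simp

lemma mccool_12: "mccool 1 2 = xi 1 * sg 1"
  using mccool_eq[of id 1 2] permutes_id[of "{1..n}"] by (simp add: theta_id cnj_def del: One_nat_def)

text \<open>Recovers sigma_k as xi_k a_(k,k+1). The step to k + 1 conjugates by xi_k xi_(k+1), which
  shifts sigma_k by \<open>xi_xi_sg\<close> and the pair of indices by
  \<open>xi_mccool\<close>.\<close>

lemma mccool_adjacent:
  assumes "1 \<le> k" "k < n"
  shows "mccool k (Suc k) = xi k * sg k"
  using assms
proof (induction k rule: dec_induct)
  case base
  then show ?case
    using mccool_12 by (simp add: numeral_2_eq_2)
next
  case (step k)
  have sg: "sg (Suc k) = xi k * xi (Suc k) * sg k * xi (Suc k) * xi k"
  proof -
    have "xi k * xi (Suc k) * sg k * xi (Suc k) * xi k =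
        sg (Suc k) * xi k * (xi (Suc k) * xi (Suc k)) * xi k"
      using xi_xi_sg[of k] step by (simp add: mult.assoc)
    then show ?thesis
      using xi_sq[of k] xi_sq[of "Suc k"] step by (simp add: mult.assoc)
  qed
  have br: "xi (Suc k) * (xi k * xi (Suc k)) = xi k * (xi (Suc k) * xi k)"
    using xi_braid[of k] step by (simp add: mult.assoc)
  have "mccool k (Suc (Suc k)) * xi (Suc k) = xi (Suc k) * mccool k (Suc k)"
    using xi_mccool[of "Suc k" k "Suc (Suc k)"] step by (simp add: transpose_def)
  moreover have "mccool (Suc k) (Suc (Suc k)) * xi k = xi k * mccool k (Suc (Suc k))"
    using xi_mccool[of k "Suc k" "Suc (Suc k)"] step by (simp add: transpose_def)
  ultimately have "mccool (Suc k) (Suc (Suc k)) * (xi k * xi (Suc k)) = xi k * xi (Suc k) * mccool k (Suc k)"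
    by (metis mult.assoc)
  also have "\<dots> = xi k * xi (Suc k) * (xi k * sg k)"
    using step by simp
  also have "\<dots> = xi (Suc k) * (xi k * xi (Suc k)) * sg k"
    by (simp add: br mult.assoc)
  also have "\<dots> = xi (Suc k) * (xi k * xi (Suc k) * sg k * xi (Suc k) * xi k) * (xi k * xi (Suc k))"
  proof -
    have "xi (Suc k) * (xi k * (xi k * xi (Suc k))) = 1"
      using xi_sq[of k] xi_sq[of "Suc k"] step by (simp flip: mult.assoc[of "xi k" "xi k"])
    then show ?thesis
      by (simp add: mult.assoc)
  qed
  finally show ?case
    unfolding sg[symmetric] by (simp only: mult_right_cancel_group)
qed

lemma mccool_relation_12_34:
  assumes "n \<ge> 4"
  shows "mccool 1 2 * mccool 3 4 = mccool 3 4 * mccool 1 2"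
proof -
  have "mccool 3 4 = xi 3 * sg 3"
    using mccool_adjacent[of 3] assms by simp
  moreover have "xi 1 * xi 3 = xi 3 * xi 1" "sg 1 * xi 3 = xi 3 * sg 1" "xi 1 * sg 3 = sg 3 * xi 1"
    "sg 1 * sg 3 = sg 3 * sg 1"
    using xi_far[of 1 3] sg_xi_far[of 1 3] sg_xi_far[of 3 1] sg_far[of 1 3] assms by simp_all
  ultimately show ?thesis
    unfolding mccool_12 by (metis commute_mult)
qed

text \<open>Substitute sigma_1 = xi_1 a_12 and sigma_2 = xi_2 a_23 into \<open>sg_sg_xi\<close> and
  \<open>sg_braid\<close> and collect the xi on the left. There they form the two sides of the braid
  relation and cancel.\<close>

lemma mccool_relations_3:
  "mccool 2 3 * mccool 1 3 = mccool 1 3 * mccool 2 3"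
  "mccool 2 3 * mccool 1 3 * mccool 1 2 = mccool 1 2 * mccool 1 3 * mccool 2 3"
proof -
  have S: "sg 1 = xi 1 * mccool 1 2" "sg 2 = xi 2 * mccool 2 3"
    using mccool_adjacent[of 1] mccool_adjacent[of 2] xi_sq[of 1] xi_sq[of 2] n_ge_3
    by (simp_all add: numeral_2_eq_2 numeral_3_eq_3 flip: mult.assoc)
  have c: "mccool 1 2 * xi 2 = xi 2 * mccool 1 3" "mccool 2 3 * xi 1 = xi 1 * mccool 1 3"
    "mccool 1 3 * xi 1 = xi 1 * mccool 2 3" "mccool 1 3 * xi 2 = xi 2 * mccool 1 2"
    using xi_mccool[of 2 1 2] xi_mccool[of 1 2 3] xi_mccool[of 1 1 3] xi_mccool[of 2 1 3] n_ge_3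
    by (simp_all add: transpose_def numeral_2_eq_2 numeral_3_eq_3)
  have c': "mccool 1 2 * (xi 2 * z) = xi 2 * (mccool 1 3 * z)" "mccool 2 3 * (xi 1 * z) = xi 1 * (mccool 1 3 * z)"
    "mccool 1 3 * (xi 1 * z) = xi 1 * (mccool 2 3 * z)" "mccool 1 3 * (xi 2 * z) = xi 2 * (mccool 1 2 * z)" for z
    by (simp_all only: c flip: mult.assoc)
  have br: "xi 2 * (xi 1 * (xi 2 * z)) = xi 1 * (xi 2 * (xi 1 * z))" for z
    using arg_cong[OF xi_braid[of 1], of "\<lambda>t. t * z"] n_ge_3 by (simp add: mult.assoc numeral_2_eq_2)
  have sgs: "sg 1 * (sg 2 * xi 1) = xi 2 * (sg 1 * sg 2)" "sg 1 * (sg 2 * sg 1) = sg 2 * (sg 1 * sg 2)"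
    using sg_sg_xi[of 1] sg_braid[of 1] n_ge_3 by (simp_all add: mult.assoc numeral_2_eq_2)
  show "mccool 2 3 * mccool 1 3 = mccool 1 3 * mccool 2 3"
    using sgs(1) unfolding S by (simp only: mult.assoc c c' br mult_left_cancel_group)
  show "mccool 2 3 * mccool 1 3 * mccool 1 2 = mccool 1 2 * mccool 1 3 * mccool 2 3"
    using sgs(2) unfolding S by (simp only: mult.assoc c c' br mult_left_cancel_group)
qed

lemma mccool_far:
  assumes "distinct [i, j, k, l]" "{i, j, k, l} \<subseteq> {1..n}"
  shows "mccool i j * mccool k l = mccool k l * mccool i j"
proof -
  obtain p where p: "p permutes {1..n}" "\<forall>m < length [i, j, k, l]. p ([i, j, k, l] ! m) = Suc m"
    using ex_permutes_list[of "[i, j, k, l]" n] assms by auto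
  have v: "p i = 1" "p j = 2" "p k = 3" "p l = 4"
    using p(2)[rule_format, of 0] p(2)[rule_format, of 1] p(2)[rule_format, of 2] p(2)[rule_format, of 3]
    by simp_all
  have "n \<ge> 4"
    using assms(2) v(4) permutes_in_image[OF p(1), of l] by auto
  have c: "mccool i j = cnj (theta p) (mccool 1 2)" "mccool k l = cnj (theta p) (mccool 3 4)"
    using cnj_theta_mccool[OF p(1), of i j] cnj_theta_mccool[OF p(1), of k l] assms v by auto
  show ?thesis
    unfolding c using mccool_relation_12_34[OF \<open>n \<ge> 4\<close>] by (simp only: flip: cnj_mult)
qed

lemma mccool_three:
  assumes "distinct [i, j, k]" "{i, j, k} \<subseteq> {1..n}"
  shows "mccool j k * mccool i k = mccool i k * mccool j k"
    and "mccool j k * mccool i k * mccool i j = mccool i j * mccool i k * mccool j k"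
proof -
  obtain p where p: "p permutes {1..n}" "\<forall>m < length [i, j, k]. p ([i, j, k] ! m) = Suc m"
    using ex_permutes_list[of "[i, j, k]" n] assms by auto
  have v: "p i = 1" "p j = 2" "p k = 3"
    using p(2)[rule_format, of 0] p(2)[rule_format, of 1] p(2)[rule_format, of 2] by simp_all
  have c: "mccool i j = cnj (theta p) (mccool 1 2)" "mccool i k = cnj (theta p) (mccool 1 3)"
    "mccool j k = cnj (theta p) (mccool 2 3)"
    using cnj_theta_mccool[OF p(1), of i j] cnj_theta_mccool[OF p(1), of i k] cnj_theta_mccool[OF p(1), of j k]
      assms v by auto
  show "mccool j k * mccool i k = mccool i k * mccool j k"
    and "mccool j k * mccool i k * mccool i j = mccool i j * mccool i k * mccool j k"
    unfolding c using mccool_relations_3 by (simp_all only: flip: cnj_mult)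
qed

text \<open>\<^term>\<open>mccool_pm (i, j, True)\<close> plays the role of the automorphism sending \<open>x\<^sub>i\<close> to \<open>x\<^sub>j\<^sup>-\<^sup>1 x\<^sub>i x\<^sub>j\<close>.\<close>

definition mccool_pm :: "nat \<times> nat \<times> bool \<Rightarrow> 'g" where
  "mccool_pm = (\<lambda>(i, j, b). if b then mccool i j else minv (mccool i j))"

text \<open>The conditions say that the two moves change different entries and neither reads the
  entry that the other changes; j = l is allowed.\<close>

lemma mccool_pm_commute:
  assumes "{i, j, k, l} \<subseteq> {1..n}" "i \<noteq> j" "k \<noteq> l" "i \<noteq> k" "i \<noteq> l" "k \<noteq> j"
  shows "mccool_pm (i, j, b) * mccool_pm (k, l, c) = mccool_pm (k, l, c) * mccool_pm (i, j, b)"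
proof -
  have "mccool i j * mccool k l = mccool k l * mccool i j"
    using assms mccool_far[of i j k l] mccool_three(1)[of k i j] by (cases "j = l") auto
  then show ?thesis
    by (auto simp: mccool_pm_def) (metis commute_minv)+
qed

text \<open>The first two factors together conjugate x_i and x_j by the same power of x_k, hence
  commute with a_ij and its inverse; this is why they share the sign \<open>b\<close>.\<close>

lemma mccool_pm_triangle:
  assumes "{i, j, k} \<subseteq> {1..n}" "distinct [i, j, k]"
  shows "mccool_pm (j, k, b) * mccool_pm (i, k, b) * mccool_pm (i, j, c) = mccool_pm (i, j, c) * mccool_pm (i, k, b) * mccool_pm (j, k, b)"
proof -
  have com': "mccool_pm (j, k, b) * mccool_pm (i, k, b) = mccool_pm (i, k, b) * mccool_pm (j, k, b)"
    using assms by (intro mccool_pm_commute) auto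
  have "mccool j k * mccool i k * mccool i j = mccool i j * (mccool j k * mccool i k)"
    using mccool_three[of i j k] assms by (simp add: mult.assoc)
  then have 1: "(mccool j k * mccool i k) * mccool_pm (i, j, c) = mccool_pm (i, j, c) * (mccool j k * mccool i k)"
    by (auto simp: mccool_pm_def) (metis commute_minv)
  have "(mccool_pm (j, k, b) * mccool_pm (i, k, b)) * mccool_pm (i, j, c) = mccool_pm (i, j, c) * (mccool_pm (j, k, b) * mccool_pm (i, k, b))"
  proof (cases b)
    case True
    then show ?thesis
      using 1 by (simp add: mccool_pm_def)
  next
    case False
    then have "mccool_pm (j, k, b) * mccool_pm (i, k, b) = minv (mccool j k * mccool i k)"
      using com' by (simp add: mccool_pm_def minv_mult)
    then show ?thesis
      using commute_minv[OF 1] by simp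
  qed
  then show ?thesis
    using com' by (simp add: mult.assoc)
qed

end

section \<open>Conjugates of free generators\<close>

definition inv_word :: "'a word \<Rightarrow> 'a word" where
  "inv_word w = rev (map (\<lambda>p. (fst p, \<not> snd p)) w)"

lemma inv_word_simps [simp]:
  "inv_word [] = []" "inv_word (p # w) = inv_word w @ [(fst p, \<not> snd p)]"
  by (simp_all add: inv_word_def)

lemma length_inv_word [simp]: "length (inv_word w) = length w"
  by (simp add: inv_word_def)

lemma inv_word_eq_Nil [simp]: "inv_word w = [] \<longleftrightarrow> w = []"
  by (simp add: inv_word_def)

lemma letter_inverse: "letter f (x, \<not> b) = minv (letter f (x, b))"
  by (simp add: letter_def)

lemma word_lift_inv_word [simp]: "word_lift f (inv_word w) = minv (word_lift f w)"
  by (induction w) (simp_all add: minv_mult letter_inverse)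

lemma reduced_Cons: "reduced (p # w) \<longleftrightarrow> reduced w \<and> (w = [] \<or> \<not> cancels p (hd w))"
  by (cases w) (auto simp: reduced_def)

lemma reduced_append:
  "reduced (u @ v) \<longleftrightarrow> reduced u \<and> reduced v \<and> (u = [] \<or> v = [] \<or> \<not> cancels (last u) (hd v))"
  by (auto simp: reduced_def successively_append_iff)

lemma reduced_inv_word: "reduced w \<Longrightarrow> reduced (inv_word w)"
proof (induction w)
  case (Cons p w)
  then show ?case
    by (cases w) (auto simp: reduced_append reduced_Cons[of _ "[]"] reduced_Cons cancels_def reduced_def[of "[]"])
qed simp

lemma hd_inv_word: "w \<noteq> [] \<Longrightarrow> hd (inv_word w) = (fst (last w), \<not> snd (last w))"
  by (simp add: inv_word_def hd_rev last_map)

lemma last_inv_word: "w \<noteq> [] \<Longrightarrow> last (inv_word w) = (fst (hd w), \<not> snd (hd w))"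
  by (simp add: inv_word_def last_rev hd_map)

section \<open>Lengths of conjugates of a generator\<close>

definition fg_len :: "'a fg \<Rightarrow> nat" where
  "fg_len g = length (Rep_fg g)"

lemma length_push: "length (push p w) \<le> Suc (length w)"
  by (cases w) auto

lemma length_reduce: "length (reduce w) \<le> length w"
  unfolding reduce_def by (induction w) (use length_push le_trans in \<open>fastforce+\<close>)

lemma fg_len_word_le: "fg_len (word w) \<le> length w"
  by (simp add: fg_len_def Rep_fg_word length_reduce)

lemma fg_len_word: "reduced w \<Longrightarrow> fg_len (word w) = length w"
  by (simp add: fg_len_def Rep_fg_word reduce_id)

definition conj_gen :: "'a \<Rightarrow> 'a word \<Rightarrow> 'a fg" where
  "conj_gen i w = minv (word w) * gen i * word w"

text \<open>Leading letters x_i and x_i^-1 of the conjugator commute with x_i. Once they are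
  stripped, w^-1 x_i w is reduced as it stands and has length 2|w| + 1.\<close>

definition normal_at :: "'a \<Rightarrow> 'a word \<Rightarrow> bool" where
  "normal_at i w \<longleftrightarrow> reduced w \<and> (w = [] \<or> fst (hd w) \<noteq> i)"

lemma conj_gen_word: "conj_gen i w = word (inv_word w @ (i, True) # w)"
  by (simp add: conj_gen_def letter_def mult.assoc)

lemma fg_len_conj_gen_le: "fg_len (conj_gen i w) \<le> 2 * length w + 1"
  using fg_len_word_le[of "inv_word w @ (i, True) # w"] by (simp add: conj_gen_word)

lemma reduced_conj_gen:
  assumes "normal_at i w"
  shows "reduced (inv_word w @ (i, True) # w)"
  using assms by (cases "w = []")
    (auto simp: normal_at_def reduced_append reduced_Cons reduced_inv_word last_inv_word cancels_def)

lemma fg_len_conj_gen: "normal_at i w \<Longrightarrow> fg_len (conj_gen i w) = 2 * length w + 1"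
  using fg_len_word[OF reduced_conj_gen, of i w] unfolding conj_gen_word by simp

lemma commute_gen_word:
  assumes "\<And>p. p \<in> set r \<Longrightarrow> fst p = i"
  shows "word r * gen i = gen i * word r"
  unfolding word_lift_def
proof (rule commute_prod_list)
  fix x
  assume "x \<in> set (map (letter gen) r)"
  then have "x = gen i \<or> x = minv (gen i)"
    using assms by (auto simp: letter_def)
  then show "x * gen i = gen i * x"
    by auto
qed

lemma conj_gen_drop:
  assumes "\<And>p. p \<in> set r \<Longrightarrow> fst p = i"
  shows "conj_gen i (r @ w) = conj_gen i w"
proof -
  have "gen i * (word r * z) = word r * (gen i * z)" for z
    using commute_gen_word[OF assms] by (simp only: flip: mult.assoc)
  then show ?thesis
    by (simp add: conj_gen_def minv_mult mult.assoc)
qed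

lemma ex_normal:
  obtains w where "normal_at i w" "minv g * gen i * g = conj_gen i w"
proof -
  let ?v = "Rep_fg g"
  let ?r = "takeWhile (\<lambda>p. fst p = i) ?v" and ?w = "dropWhile (\<lambda>p. fst p = i) ?v"
  have "reduced (?r @ ?w)"
    using Rep_fg[of g] by simp
  then have "normal_at i ?w"
    using hd_dropWhile[of "\<lambda>p. fst p = i" ?v] unfolding reduced_append normal_at_def by blast
  moreover have "minv g * gen i * g = conj_gen i (?r @ ?w)"
    by (simp only: conj_gen_def takeWhile_dropWhile_id word_Rep_fg)
  moreover have "\<dots> = conj_gen i ?w"
    by (rule conj_gen_drop) (auto dest: set_takeWhileD)
  ultimately show ?thesis
    using that[of ?w] by argo
qed

lemma common_suffix:
  obtains p q c where "w = p @ c" "v = q @ c" "p = [] \<or> q = [] \<or> last p \<noteq> last q"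
proof -
  have "\<exists>p q c. w = p @ c \<and> v = q @ c \<and> (p = [] \<or> q = [] \<or> last p \<noteq> last q)"
  proof (induction w arbitrary: v rule: rev_induct)
    case Nil
    show ?case by simp
  next
    case (snoc x w)
    show ?case
    proof (cases "v \<noteq> [] \<and> last v = x")
      case True
      then obtain v' where v: "v = v' @ [x]"
        by (metis append_butlast_last_id)
      obtain p q c where "w = p @ c" "v' = q @ c" "p = [] \<or> q = [] \<or> last p \<noteq> last q"
        using snoc[of v'] by blast
      then show ?thesis
        unfolding v by (intro exI[of _ p] exI[of _ q] exI[of _ "c @ [x]"]) simp
    next
      case False
      then show ?thesis
        by (intro exI[of _ "w @ [x]"] exI[of _ v] exI[of _ "[]"]) auto
    qed
  qed
  then show ?thesis
    using that by blast
qed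

lemma letter_conj_gen:
  assumes "y j = conj_gen j v"
  shows "letter y (j, b) = minv (word v) * letter gen (j, b) * word v"
  using assms by (simp add: letter_def conj_gen_def minv_mult mult.assoc)

lemma conj_conj_gen: "minv (word z) * conj_gen i w * word z = conj_gen i (w @ z)"
  by (simp add: conj_gen_def minv_mult mult.assoc)

section \<open>Moves and their effect on the conjugators\<close>

definition move :: "'a \<times> 'a \<times> bool \<Rightarrow> ('a \<Rightarrow> 'g::group_mult) \<Rightarrow> 'a \<Rightarrow> 'g" where
  "move = (\<lambda>(i, j, b) y. y(i := minv (letter y (j, b)) * y i * letter y (j, b)))"

text \<open>Conjugation by the letter multiplies the conjugator on the right by v^-1 x_j^e v, where
  e is the sign given by \<open>b\<close>, so that the suffix x_j^-e v collapses to v.\<close>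

lemma conj_gen_down:
  assumes "y i = conj_gen i (u @ (j, \<not> b) # v)" "y j = conj_gen j v"
  shows "minv (letter y (j, b)) * y i * letter y (j, b) = conj_gen i (u @ v)"
  unfolding letter_conj_gen[of y j v b, OF assms(2)] assms(1)
  by (simp add: conj_gen_def letter_inverse group_norm)

text \<open>A move that does not shorten the \<open>i\<close>-th entry lengthens it, and leaves behind the trace of
  \<open>y\<^sub>j\<close> that the inverse move cancels.\<close>

lemma conj_gen_up:
  assumes i: "y i = conj_gen i w" "normal_at i w" and j: "y j = conj_gen j v" "normal_at j v"
    and ij: "i \<noteq> j" and nd: "\<And>u. w \<noteq> u @ (j, \<not> b) # v"
  shows "\<exists>u. normal_at i (u @ (j, b) # v) \<and>
      minv (letter y (j, b)) * y i * letter y (j, b) = conj_gen i (u @ (j, b) # v)"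
proof -
  \<comment> \<open>Without the common suffix c, the new conjugator w v^-1 x_j^e v reads p q^-1
    x_j^e v. If p ended in x_j^-e with q empty, then w would end in x_j^-e v, against
    \<open>nd\<close>.\<close>
  obtain p q c where w: "w = p @ c" and v: "v = q @ c" and pq: "p = [] \<or> q = [] \<or> last p \<noteq> last q"
    by (rule common_suffix)
  have red: "reduced p" "reduced q" "reduced c" "reduced v"
    using i(2) j(2) by (auto simp: w v normal_at_def reduced_append)
  have z: "letter y (j, b) = word (inv_word c @ inv_word q @ (j, b) # v)"
    using letter_conj_gen[of y j v b, OF j(1)] by (simp add: v minv_mult mult.assoc)
  have new: "minv (letter y (j, b)) * y i * letter y (j, b) = conj_gen i (p @ inv_word q @ (j, b) # v)"
    unfolding z i(1) conj_conj_gen by (simp add: conj_gen_def w mult.assoc minv_mult)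
  have jv: "reduced ((j, b) # v)"
    using j(2) red by (auto simp: reduced_Cons normal_at_def cancels_def)
  show ?thesis
  proof (cases "p = []")
    case False
    have "last p \<noteq> (j, \<not> b)" if "q = []"
      using nd[of "butlast p"] False that w v by (metis append_Cons append_Nil append_butlast_last_id append_assoc)
    then have 1: "\<not> cancels (last p) (j, b)" if "q = []"
      using that by (auto simp: cancels_def prod_eq_iff)
    have 2: "\<not> cancels (last p) (hd (inv_word q))" if "q \<noteq> []"
      using pq that False by (auto simp: hd_inv_word cancels_def prod_eq_iff)
    have 3: "\<not> cancels (last (inv_word q)) (j, b)" if "q \<noteq> []"
      using j(2) that by (auto simp: v normal_at_def last_inv_word cancels_def)
    have "reduced (p @ inv_word q @ (j, b) # v)"
      using jv red 1 2 3 False by (cases "q = []") (simp_all add: reduced_append reduced_inv_word)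
    moreover have "fst (hd (p @ inv_word q @ (j, b) # v)) \<noteq> i"
      using i(2) False by (simp add: w normal_at_def)
    ultimately have "normal_at i ((p @ inv_word q) @ (j, b) # v)"
      by (simp add: normal_at_def)
    then show ?thesis
      using new by (metis append_assoc)
  next
    case True
    \<comment> \<open>With p empty the conjugator begins with q^-1. Its leading letters x_i and
      x_i^-1, which come from the trailing block \<open>r\<close> of q, commute with x_i and are
      dropped.\<close>
    define r where "r = rev (takeWhile (\<lambda>x. fst x = i) (rev q))"
    define s where "s = rev (dropWhile (\<lambda>x. fst x = i) (rev q))"
    have q: "q = s @ r"
      unfolding r_def s_def by (metis rev_append rev_rev_ident takeWhile_dropWhile_id)
    have r: "fst x = i" if "x \<in> set r" for x
      using that by (auto simp: r_def dest: set_takeWhileD)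
    have s: "fst (last s) \<noteq> i" if "s \<noteq> []"
      using that hd_dropWhile[of "\<lambda>x. fst x = i" "rev q"] by (simp add: s_def last_rev)
    have ri: "fst x = i" if "x \<in> set (inv_word r)" for x
      using that r by (auto simp: inv_word_def)
    have "inv_word q = inv_word r @ inv_word s"
      by (simp add: q inv_word_def)
    then have "conj_gen i (p @ inv_word q @ (j, b) # v) = conj_gen i (inv_word s @ (j, b) # v)"
      using True conj_gen_drop[OF ri, of "inv_word r" "inv_word s @ (j, b) # v"] by simp
    moreover have "normal_at i (inv_word s @ (j, b) # v)"
    proof (cases "s = []")
      case False
      have "\<not> cancels (last (inv_word s)) (j, b)"
        using j(2) False by (auto simp: v q normal_at_def last_inv_word cancels_def)
      moreover have "reduced s"
        using red by (simp add: q reduced_append)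
      ultimately show ?thesis
        using jv s False hd_inv_word[OF False]
        by (auto simp: normal_at_def reduced_append reduced_inv_word hd_append)
    qed (use jv ij in \<open>simp add: normal_at_def\<close>)
    ultimately show ?thesis
      using new by auto
  qed
qed

text \<open>A move that strips no suffix produces one that the inverse move strips. So every move is
  strict, and whether it descends is decided by comparing suffixes.\<close>

lemma conj_gen_move_less_iff:
  assumes "y i = conj_gen i w" "normal_at i w" "y j = conj_gen j v" "normal_at j v" "i \<noteq> j"
  shows "fg_len (minv (letter y (j, b)) * y i * letter y (j, b)) < fg_len (y i) \<longleftrightarrow>
      (\<exists>u. w = u @ (j, \<not> b) # v)"
    and "fg_len (minv (letter y (j, b)) * y i * letter y (j, b)) \<noteq> fg_len (y i)"
proof -
  let ?z = "minv (letter y (j, b)) * y i * letter y (j, b)"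
  have down: "fg_len ?z < fg_len (y i)" if "w = u @ (j, \<not> b) # v" for u
    using conj_gen_down[of y i u j b v] assms that fg_len_conj_gen_le[of i "u @ v"]
      fg_len_conj_gen[OF assms(2)] by simp
  have up: "fg_len (y i) < fg_len ?z" if nd: "\<And>u. w \<noteq> u @ (j, \<not> b) # v"
  proof -
    obtain u where u: "normal_at i (u @ (j, b) # v)" "?z = conj_gen i (u @ (j, b) # v)"
      using conj_gen_up[OF assms nd] by blast
    define y' where "y' = y(i := ?z)"
    have y': "y' i = conj_gen i (u @ (j, \<not> \<not> b) # v)" "y' j = conj_gen j v"
      using u assms by (simp_all add: y'_def)
    have "letter y' (j, \<not> b) = minv (letter y (j, b))"
      using assms by (simp add: y'_def letter_def)
    then have "minv (letter y' (j, \<not> b)) * y' i * letter y' (j, \<not> b) = y i"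
      by (simp add: y'_def mult.assoc)
    then have "y i = conj_gen i (u @ v)"
      using conj_gen_down[OF y'] by simp
    then show ?thesis
      using u fg_len_conj_gen[OF u(1)] fg_len_conj_gen_le[of i "u @ v"] by simp
  qed
  show "fg_len ?z < fg_len (y i) \<longleftrightarrow> (\<exists>u. w = u @ (j, \<not> b) # v)"
    using down up by (metis less_asym)
  show "fg_len ?z \<noteq> fg_len (y i)"
    using down up by (cases "\<exists>u. w = u @ (j, \<not> b) # v") force+
qed

section \<open>The potential on tuples of conjugates\<close>

definition moves :: "nat \<Rightarrow> (nat \<times> nat \<times> bool) set" where
  "moves n = {(i, j, b). i \<in> {1..n} \<and> j \<in> {1..n} \<and> i \<noteq> j}"

text \<open>Such a tuple need not generate the free group, and a tuple without a shortening move
  need not be \<open>gen\<close>; the potential is defined on all of them.\<close>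

definition conj_tuples :: "nat \<Rightarrow> (nat \<Rightarrow> nat fg) set" where
  "conj_tuples n = {y. \<forall>i\<in>{1..n}. \<exists>w. normal_at i w \<and> y i = conj_gen i w}"

definition tuple_len :: "nat \<Rightarrow> (nat \<Rightarrow> 'a fg) \<Rightarrow> nat" where
  "tuple_len n y = (\<Sum>i = 1..n. fg_len (y i))"

lemma tuple_len_upd:
  assumes "i \<in> {1..n}"
  shows "tuple_len n (y(i := z)) + fg_len (y i) = tuple_len n y + fg_len z"
proof -
  have "(\<Sum>k\<in>{1..n} - {i}. fg_len ((y(i := z)) k)) = (\<Sum>k\<in>{1..n} - {i}. fg_len (y k))"
    by (rule sum.cong) auto
  then show ?thesis
    unfolding tuple_len_def sum.remove[OF finite_atLeastAtMost assms] by simp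
qed

lemma move_apply: "move (i, j, b) y = y(i := minv (letter y (j, b)) * y i * letter y (j, b))"
  by (simp add: move_def)

lemma letter_upd: "i \<noteq> j \<Longrightarrow> letter (y(i := z)) (j, b) = letter y (j, b)"
  by (simp add: letter_def)

lemma move_inverse:
  assumes "i \<noteq> j"
  shows "move (i, j, \<not> b) (move (i, j, b) y) = y"
  using assms by (simp add: move_apply letter_upd letter_inverse mult.assoc)

lemma conj_tuples_upd:
  assumes "y \<in> conj_tuples n" "i \<in> {1..n}"
  shows "y(i := minv g * y i * g) \<in> conj_tuples n"
proof -
  obtain w where "y i = conj_gen i w"
    using assms unfolding conj_tuples_def by blast
  then have "minv g * y i * g = minv (word w * g) * gen i * (word w * g)"
    by (simp add: conj_gen_def group_norm)
  moreover obtain v where "normal_at i v" "minv (word w * g) * gen i * (word w * g) = conj_gen i v"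
    by (rule ex_normal)
  ultimately show ?thesis
    using assms by (auto simp: conj_tuples_def)
qed

lemma move_closed: "a \<in> moves n \<Longrightarrow> y \<in> conj_tuples n \<Longrightarrow> move a y \<in> conj_tuples n"
  by (auto simp: moves_def move_apply intro!: conj_tuples_upd)

lemma tuple_len_move_less_iff:
  assumes "(i, j, b) \<in> moves n"
  shows "tuple_len n (move (i, j, b) y) < tuple_len n y \<longleftrightarrow>
      fg_len (minv (letter y (j, b)) * y i * letter y (j, b)) < fg_len (y i)"
    and "tuple_len n (move (i, j, b) y) = tuple_len n y \<longleftrightarrow>
      fg_len (minv (letter y (j, b)) * y i * letter y (j, b)) = fg_len (y i)"
  using assms tuple_len_upd[of i n y "minv (letter y (j, b)) * y i * letter y (j, b)"]
  by (auto simp: moves_def move_apply)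

lemma tuple_len_move_neq:
  assumes "a \<in> moves n" "y \<in> conj_tuples n"
  shows "tuple_len n (move a y) \<noteq> tuple_len n y"
proof -
  obtain i j b where a: "a = (i, j, b)"
    by (cases a) auto
  then have ij: "i \<in> {1..n}" "j \<in> {1..n}" "i \<noteq> j"
    using assms by (auto simp: moves_def)
  obtain w v where "normal_at i w" "y i = conj_gen i w" "normal_at j v" "y j = conj_gen j v"
    using assms(2) ij unfolding conj_tuples_def by blast
  then show ?thesis
    unfolding a using tuple_len_move_less_iff(2)[OF assms(1)[unfolded a]] conj_gen_move_less_iff(2) ij by metis
qed

lemma gen_conj_tuples: "gen \<in> conj_tuples n"
proof -
  have "normal_at i [] \<and> gen i = conj_gen i []" for i :: nat
    by (simp add: normal_at_def conj_gen_def reduced_def)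
  then show ?thesis
    unfolding conj_tuples_def by blast
qed

lemma tuple_len_gen_move:
  assumes "a \<in> moves n"
  shows "\<not> tuple_len n (move a gen) < tuple_len n gen"
proof -
  obtain i j b where a: "a = (i, j, b)"
    by (cases a) auto
  have i: "i \<in> {1..n}"
    using assms by (auto simp: a moves_def)
  have "move a gen \<in> conj_tuples n"
    using assms by (intro move_closed gen_conj_tuples)
  then obtain w where "normal_at i w" "move a gen i = conj_gen i w"
    using i unfolding conj_tuples_def by blast
  then have "1 \<le> fg_len (move a gen i)"
    by (simp add: fg_len_conj_gen)
  moreover have "fg_len (gen i) = 1"
    using fg_len_word[of "free_gen i"] by (simp add: reduced_def free_gen_def letter_def)
  ultimately show ?thesis
    using tuple_len_upd[OF i, of gen "move a gen i"] by (simp add: a move_apply)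
qed

section \<open>Local confluence of the moves\<close>

context standard_relations
begin

definition compatible_below :: "((nat \<Rightarrow> nat fg) \<Rightarrow> 'g) \<Rightarrow> (nat \<Rightarrow> nat fg) \<Rightarrow> bool" where
  "compatible_below \<theta> t \<longleftrightarrow> (\<forall>c\<in>moves n. \<forall>s\<in>conj_tuples n.
     tuple_len n s < tuple_len n t \<longrightarrow> tuple_len n (move c s) < tuple_len n t \<longrightarrow>
     \<theta> (move c s) = mccool_pm c * \<theta> s)"

text \<open>The conclusion that \<open>confluent_potential\<close> demands at a peak
  \<open>t\<close>. It is transitive, so two descending moves may be joined through a third.\<close>

definition agree :: "((nat \<Rightarrow> nat fg) \<Rightarrow> 'g) \<Rightarrow> (nat \<Rightarrow> nat fg) \<Rightarrow> nat \<times> nat \<times> bool \<Rightarrow> nat \<times> nat \<times> bool \<Rightarrow> bool" where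
  "agree \<theta> t a b \<longleftrightarrow> minv (mccool_pm a) * \<theta> (move a t) = minv (mccool_pm b) * \<theta> (move b t)"

lemma agree_sym: "agree \<theta> t a b \<Longrightarrow> agree \<theta> t b a"
  and agree_trans: "agree \<theta> t a b \<Longrightarrow> agree \<theta> t b c \<Longrightarrow> agree \<theta> t a c"
  by (auto simp: agree_def)

lemma compatible_belowD:
  assumes "compatible_below \<theta> t" "c \<in> moves n" "s \<in> conj_tuples n"
    "tuple_len n s < tuple_len n t" "tuple_len n (move c s) < tuple_len n t"
  shows "\<theta> (move c s) = mccool_pm c * \<theta> s"
  using assms unfolding compatible_below_def by blast

text \<open>The peak closes to a square: each move has the same effect on its entry whether or not
  the other has been made, so the far corner lies lower still.\<close>

lemma agree_commuting:
  assumes \<theta>: "compatible_below \<theta> t" and t: "t \<in> conj_tuples n"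
    and m: "(i, j, b) \<in> moves n" "(k, l, c) \<in> moves n"
    and less: "tuple_len n (move (i, j, b) t) < tuple_len n t" "tuple_len n (move (k, l, c) t) < tuple_len n t"
    and ne: "i \<noteq> k" "i \<noteq> l" "k \<noteq> j"
  shows "agree \<theta> t (i, j, b) (k, l, c)"
proof -
  let ?p = "minv (letter t (j, b)) * t i * letter t (j, b)" and ?q = "minv (letter t (l, c)) * t k * letter t (l, c)"
  have ik: "i \<in> {1..n}" "k \<in> {1..n}"
    using m by (auto simp: moves_def)
  have eq: "move (k, l, c) (move (i, j, b) t) = t(i := ?p, k := ?q)"
    "move (i, j, b) (move (k, l, c) t) = t(i := ?p, k := ?q)"
    using ne by (auto simp: move_apply letter_upd fun_upd_twist)
  have "tuple_len n (t(i := ?p, k := ?q)) < tuple_len n t"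
    using less tuple_len_upd[OF ik(1), of t ?p] tuple_len_upd[OF ik(2), of "t(i := ?p)" ?q] ne
    by (simp add: tuple_len_move_less_iff m)
  then have "mccool_pm (k, l, c) * \<theta> (move (i, j, b) t) = mccool_pm (i, j, b) * \<theta> (move (k, l, c) t)"
    using compatible_belowD[OF \<theta> m(2) move_closed[OF m(1) t] less(1)]
      compatible_belowD[OF \<theta> m(1) move_closed[OF m(2) t] less(2)] by (simp add: eq)
  then have "mccool_pm (k, l, c) * mccool_pm (i, j, b) * (minv (mccool_pm (i, j, b)) * \<theta> (move (i, j, b) t)) =
      mccool_pm (i, j, b) * mccool_pm (k, l, c) * (minv (mccool_pm (k, l, c)) * \<theta> (move (k, l, c) t))"
    by (simp add: mult.assoc)
  moreover have "mccool_pm (k, l, c) * mccool_pm (i, j, b) = mccool_pm (i, j, b) * mccool_pm (k, l, c)"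
    using m ne by (intro mccool_pm_commute) (auto simp: moves_def)
  ultimately show ?thesis
    by (simp only: agree_def mult_left_cancel_group)
qed

text \<open>The conjugator of entry l contains x_j^-e v as a suffix too. On either side the move (l,
  j, b) shortens it to s v, after which the other of the two given moves brings the conjugator of
  entry i to u s v. The two paths spell the two sides of McCool's triangle relation.\<close>

lemma agree_triangle:
  assumes \<theta>: "compatible_below \<theta> t" and t: "t \<in> conj_tuples n"
    and ijl: "i \<in> {1..n}" "j \<in> {1..n}" "l \<in> {1..n}" "distinct [i, j, l]"
    and w: "normal_at i (u @ (l, \<not> c) # s @ (j, \<not> b) # v)" "t i = conj_gen i (u @ (l, \<not> c) # s @ (j, \<not> b) # v)"
    and v': "normal_at l (s @ (j, \<not> b) # v)" "t l = conj_gen l (s @ (j, \<not> b) # v)"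
    and v: "normal_at j v" "t j = conj_gen j v"
  shows "agree \<theta> t (i, j, b) (i, l, c)"
proof -
  define g h where "g = letter t (j, b)" and "h = letter t (l, c)"
  let ?p = "minv g * t i * g" and ?p' = "minv h * t i * h" and ?q = "minv g * t l * g"
  let ?r = "minv g * (minv h * t i * h) * g"
  have m: "(i, j, b) \<in> moves n" "(i, l, c) \<in> moves n" "(l, j, b) \<in> moves n"
    using ijl by (auto simp: moves_def)
  have p: "fg_len ?p < fg_len (t i)"
    unfolding g_def using conj_gen_move_less_iff(1)[OF w(2,1) v(2,1), of b] ijl(4)
    by (auto intro: exI[of _ "u @ (l, \<not> c) # s"])
  have p': "fg_len ?p' < fg_len (t i)"
    unfolding h_def using conj_gen_move_less_iff(1)[OF w(2,1) v'(2,1), of c] ijl(4) by auto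
  have q: "fg_len ?q < fg_len (t l)"
    unfolding g_def using conj_gen_move_less_iff(1)[OF v'(2,1) v(2,1), of b] ijl(4) by auto
  have "?p' = conj_gen i ((u @ s) @ (j, \<not> b) # v)"
    unfolding h_def using conj_gen_down[OF w(2) v'(2)] by simp
  then have "?r = conj_gen i ((u @ s) @ v)"
    using conj_gen_down[of "t(i := ?p')" i "u @ s" j b v] v(2) ijl(4) by (simp add: letter_upd g_def)
  then have r: "fg_len ?r < fg_len (t i)"
    using fg_len_conj_gen_le[of i "(u @ s) @ v"] fg_len_conj_gen[OF w(1)] w(2) by simp
  have upd: "tuple_len n (t(i := x)) < tuple_len n t" if "fg_len x < fg_len (t i)" for x
    using tuple_len_upd[OF ijl(1), of t x] that by simp
  have upd2: "tuple_len n (t(i := x, l := ?q)) < tuple_len n t" if "fg_len x < fg_len (t i)" for x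
    using tuple_len_upd[OF ijl(1), of t x] tuple_len_upd[OF ijl(3), of "t(i := x)" ?q] that q ijl(4) by simp
  have t1: "move (i, j, b) t = t(i := ?p)" "move (i, l, c) t = t(i := ?p')"
    by (simp_all add: move_apply g_def h_def)
  have t2: "move (l, j, b) (t(i := x)) = t(i := x, l := ?q)" for x
    using ijl(4) by (simp add: move_apply letter_upd g_def)
  \<comment> \<open>Entry l has itself been conjugated by \<open>g\<close>, so the next move uses
    g^-1 h g in place of \<open>h\<close>; in total, entry i is conjugated by \<open>h\<close> and
    then by \<open>g\<close>.\<close>
  have hq: "letter (t(i := x, l := ?q)) (l, c) = minv g * h * g" for x
    using ijl(4) by (simp add: letter_def h_def group_norm)
  have t3: "move (i, l, c) (t(i := ?p, l := ?q)) = t(i := ?r, l := ?q)"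
    unfolding move_apply hq using ijl(4) by (simp add: fun_upd_twist group_norm)
  have t3': "move (i, j, b) (t(i := ?p', l := ?q)) = t(i := ?r, l := ?q)"
    using ijl(4) by (simp add: move_apply letter_upd fun_upd_twist g_def)
  have clo: "t(i := ?p) \<in> conj_tuples n" "t(i := ?p') \<in> conj_tuples n"
    using t ijl(1) by (rule conj_tuples_upd)+
  have clo2: "t(i := ?p, l := ?q) \<in> conj_tuples n" "t(i := ?p', l := ?q) \<in> conj_tuples n"
    using move_closed[OF m(3) clo(1)] move_closed[OF m(3) clo(2)] by (simp_all only: t2)
  have "\<theta> (t(i := ?r, l := ?q)) = mccool_pm (i, l, c) * (mccool_pm (l, j, b) * \<theta> (t(i := ?p)))"
    using compatible_belowD[OF \<theta> m(2) clo2(1)] compatible_belowD[OF \<theta> m(3) clo(1)]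
    by (simp add: t2 t3 upd upd2 p q r)
  moreover have "\<theta> (t(i := ?r, l := ?q)) = mccool_pm (i, j, b) * (mccool_pm (l, j, b) * \<theta> (t(i := ?p')))"
    using compatible_belowD[OF \<theta> m(1) clo2(2)] compatible_belowD[OF \<theta> m(3) clo(2)]
    by (simp add: t2 t3' upd upd2 p' q r)
  ultimately have "mccool_pm (i, l, c) * mccool_pm (l, j, b) * mccool_pm (i, j, b) * (minv (mccool_pm (i, j, b)) * \<theta> (t(i := ?p))) =
      mccool_pm (i, j, b) * mccool_pm (l, j, b) * mccool_pm (i, l, c) * (minv (mccool_pm (i, l, c)) * \<theta> (t(i := ?p')))"
    by (simp add: mult.assoc)
  moreover have "mccool_pm (i, l, c) * mccool_pm (l, j, b) * mccool_pm (i, j, b) = mccool_pm (i, j, b) * mccool_pm (l, j, b) * mccool_pm (i, l, c)"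
  proof -
    have "mccool_pm (l, j, b) * mccool_pm (i, j, b) = mccool_pm (i, j, b) * mccool_pm (l, j, b)"
      using ijl by (intro mccool_pm_commute) auto
    then show ?thesis
      using mccool_pm_triangle[of i l j b c] ijl by (simp add: mult.assoc)
  qed
  ultimately show ?thesis
    unfolding agree_def t1 by (simp only: mult_left_cancel_group)
qed

text \<open>Two suffixes of one word are comparable, so descending moves on the same entry coincide
  or are in the position of \<open>agree_triangle\<close>. Moves on different entries form a square
  unless one changes the entry that the other reads.\<close>

lemma agree_descending:
  assumes \<theta>: "compatible_below \<theta> t" and t: "t \<in> conj_tuples n"
    and m: "a \<in> moves n" "b \<in> moves n"
    and less: "tuple_len n (move a t) < tuple_len n t" "tuple_len n (move b t) < tuple_len n t"
  shows "agree \<theta> t a b"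
proof -
  obtain W where W: "\<And>i. i \<in> {1..n} \<Longrightarrow> normal_at i (W i)" "\<And>i. i \<in> {1..n} \<Longrightarrow> t i = conj_gen i (W i)"
    using t bchoice[of "{1..n}" "\<lambda>i w. normal_at i w \<and> t i = conj_gen i w"] unfolding conj_tuples_def by blast
  define down where "down a \<longleftrightarrow> a \<in> moves n \<and> tuple_len n (move a t) < tuple_len n t" for a
  have down_iff: "down (i, j, b) \<longleftrightarrow> (i, j, b) \<in> moves n \<and> (\<exists>u. W i = u @ (j, \<not> b) # W j)" for i j b
  proof (cases "(i, j, b) \<in> moves n")
    case True
    then have "i \<in> {1..n}" "j \<in> {1..n}" "i \<noteq> j"
      by (auto simp: moves_def)
    then show ?thesis
      using conj_gen_move_less_iff(1)[of t i "W i" j "W j" b] W tuple_len_move_less_iff(1)[OF True, of t]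
        True by (simp add: down_def)
  qed (simp add: down_def)
  have shorter: "length (W j) < length (W i)" if "down (i, j, b)" for i j b
    using that by (auto simp: down_iff)
  have below: "agree \<theta> t (i, j, b) (i, l, c)"
    if d: "down (i, j, b)" "down (i, l, c)" and le: "length (W j) \<le> length (W l)" for i j l b c
  proof -
    obtain u u' where u: "W i = u @ (j, \<not> b) # W j" "W i = u' @ (l, \<not> c) # W l"
      using d by (auto simp: down_iff)
    have eq: "u @ (j, \<not> b) # W j = u' @ (l, \<not> c) # W l"
      by (rule trans[OF u(1)[symmetric] u(2)])
    show ?thesis
    proof (cases "length (W j) = length (W l)")
      case True
      then have "(j, \<not> b) # W j = (l, \<not> c) # W l"
        using append_eq_append_conv[of u u' "(j, \<not> b) # W j" "(l, \<not> c) # W l"] eq by simp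
      then show ?thesis
        by (simp add: agree_def)
    next
      case False
      have "u @ (j, \<not> b) # W j = (u' @ [(l, \<not> c)]) @ W l"
        using eq by simp
      then obtain s where s: "u @ s = u' @ [(l, \<not> c)] \<and> (j, \<not> b) # W j = s @ W l \<or>
          u = (u' @ [(l, \<not> c)]) @ s \<and> s @ (j, \<not> b) # W j = W l"
        unfolding append_eq_append_conv2 by blast
      have "length ((j, \<not> b) # W j) \<le> length (W l)"
        using le False by simp
      then have Wl: "W l = s @ (j, \<not> b) # W j"
        using s
      proof (elim disjE conjE)
        assume *: "(j, \<not> b) # W j = s @ W l"
        have "length s = 0"
          using arg_cong[OF *, of length] le False unfolding length_Cons length_append by linarith
        with * show ?thesis
          by simp
      qed simp
      have ijl: "i \<in> {1..n}" "j \<in> {1..n}" "l \<in> {1..n}" "i \<noteq> j" "i \<noteq> l" "j \<noteq> l"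
        using d False by (auto simp: down_def moves_def)
      show ?thesis
        using ijl W[OF ijl(1), unfolded u(2) Wl] W[OF ijl(3), unfolded Wl] W[OF ijl(2)]
        by (intro agree_triangle[OF \<theta> t, where u = u' and s = s and v = "W j"]) simp_all
    qed
  qed
  have same: "agree \<theta> t (i, j, b) (i, l, c)" if "down (i, j, b)" "down (i, l, c)" for i j l b c
    using below[OF that] below[OF that(2,1)] agree_sym nle_le by metis
  have commuting: "agree \<theta> t (i, j, b) (k, l, c)"
    if "down (i, j, b)" "down (k, l, c)" "i \<noteq> k" "i \<noteq> l" "k \<noteq> j" for i j k l b c
    using that unfolding down_def by (intro agree_commuting[OF \<theta> t]) auto
  \<comment> \<open>\<open>W k\<close> ends in \<open>W i\<close> and hence in x_j^-e followed by
    \<open>W j\<close>, so (k, j, b) descends too. It commutes with the first move and changes the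
    same entry as the second.\<close>
  have chain: "agree \<theta> t (i, j, b) (k, i, c)" if d: "down (i, j, b)" "down (k, i, c)" for i j k b c
  proof -
    obtain u u' where "W i = u @ (j, \<not> b) # W j" "W k = u' @ (i, \<not> c) # W i"
      using d by (auto simp: down_iff)
    then have "W k = (u' @ (i, \<not> c) # u) @ (j, \<not> b) # W j"
      by simp
    moreover have kj: "k \<noteq> j" "k \<noteq> i" "i \<noteq> j"
      using shorter[OF d(1)] shorter[OF d(2)] by auto
    ultimately have kjb: "down (k, j, b)"
      using d unfolding down_iff by (auto simp: moves_def)
    have "agree \<theta> t (i, j, b) (k, j, b)"
      using commuting[OF d(1) kjb] kj by simp
    then show ?thesis
      using agree_trans same[OF kjb d(2)] by blast
  qed
  obtain i j x k l y where ab: "a = (i, j, x)" "b = (k, l, y)"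
    by (cases a; cases b) auto
  then have d: "down (i, j, x)" "down (k, l, y)"
    using m less by (simp_all add: down_def)
  consider "i = k" | "i = l" | "k = j" | "i \<noteq> k" "i \<noteq> l" "k \<noteq> j"
    by blast
  then show ?thesis
    unfolding ab
  proof cases
    case 1
    then show "agree \<theta> t (i, j, x) (k, l, y)"
      using same d by simp
  next
    case 2
    then show "agree \<theta> t (i, j, x) (k, l, y)"
      using chain d by simp
  next
    case 3
    then show "agree \<theta> t (i, j, x) (k, l, y)"
      using chain[of j l y i x] d agree_sym by blast
  next
    case 4
    then show "agree \<theta> t (i, j, x) (k, l, y)"
      using commuting d by simp
  qed
qed

lemma ex_pot:
  "\<exists>\<theta>. (\<forall>a\<in>moves n. \<forall>t\<in>conj_tuples n. \<theta> (move a t) = mccool_pm a * \<theta> t) \<and> \<theta> gen = 1"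
proof -
  have "\<exists>\<theta>. (\<forall>a\<in>moves n. \<forall>t\<in>conj_tuples n. \<theta> (move a t) = mccool_pm a * \<theta> t) \<and>
      (\<forall>t\<in>conj_tuples n. (\<forall>a\<in>moves n. \<not> tuple_len n (move a t) < tuple_len n t) \<longrightarrow> \<theta> t = 1)"
  proof (rule confluent_potential[where bar = "\<lambda>(i, j, b). (i, j, \<not> b)"])
    fix \<theta> a b t
    assume "a \<in> moves n" "b \<in> moves n" "t \<in> conj_tuples n" "tuple_len n (move a t) < tuple_len n t"
      "tuple_len n (move b t) < tuple_len n t"
      and "\<And>c s. \<lbrakk>c \<in> moves n; s \<in> conj_tuples n; tuple_len n s < tuple_len n t;
        tuple_len n (move c s) < tuple_len n t\<rbrakk> \<Longrightarrow> \<theta> (move c s) = mccool_pm c * \<theta> s"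
    then show "minv (mccool_pm a) * \<theta> (move a t) = minv (mccool_pm b) * \<theta> (move b t)"
      using agree_descending[of \<theta> t a b] by (simp add: compatible_below_def agree_def)
  qed (auto simp: move_closed tuple_len_move_neq moves_def move_inverse mccool_pm_def)
  then show ?thesis
    using gen_conj_tuples tuple_len_gen_move by blast
qed

definition pot :: "(nat \<Rightarrow> nat fg) \<Rightarrow> 'g" where
  "pot = (SOME \<theta>. (\<forall>a\<in>moves n. \<forall>t\<in>conj_tuples n. \<theta> (move a t) = mccool_pm a * \<theta> t) \<and> \<theta> gen = 1)"

lemma pot_gen: "pot gen = 1"
  and pot_move: "a \<in> moves n \<Longrightarrow> t \<in> conj_tuples n \<Longrightarrow> pot (move a t) = mccool_pm a * pot t"
  using someI_ex[OF ex_pot] by (simp_all add: pot_def)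

end

section \<open>The action of words on tuples\<close>

text \<open>If \<open>y\<close> lists the images of the x_i under an automorphism g, the result
  lists those under sigma_k followed by g. The formula makes sense for tuples in any group.\<close>

definition sigma_fun :: "nat \<Rightarrow> (nat \<Rightarrow> 'g::group_mult) \<Rightarrow> nat \<Rightarrow> 'g" where
  "sigma_fun k y = y(k := y (Suc k), Suc k := minv (y (Suc k)) * y k * y (Suc k))"

definition xi_fun :: "nat \<Rightarrow> (nat \<Rightarrow> 'g) \<Rightarrow> nat \<Rightarrow> 'g" where
  "xi_fun k y = y(k := y (Suc k), Suc k := y k)"

lemma bij_sigma_fun: "bij (sigma_fun k)"
  by (rule bij_betw_byWitness[where f' = "\<lambda>y. y(k := y k * y (Suc k) * minv (y k), Suc k := y k)"])
    (auto simp: sigma_fun_def fun_eq_iff mult.assoc)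

lemma bij_xi_fun: "bij (xi_fun k)"
  by (rule bij_betw_byWitness[where f' = "xi_fun k"]) (auto simp: xi_fun_def fun_eq_iff)

definition sigma_perm :: "nat \<Rightarrow> (nat \<Rightarrow> 'g::group_mult) permutation" where
  "sigma_perm k = Perm (sigma_fun k)"

definition xi_perm :: "nat \<Rightarrow> (nat \<Rightarrow> 'g) permutation" where
  "xi_perm k = Perm (xi_fun k)"

lemma perm_fun_sigma_perm: "perm_fun (sigma_perm k) = sigma_fun k"
  and perm_fun_xi_perm: "perm_fun (xi_perm k) = xi_fun k"
  by (simp_all add: sigma_perm_def xi_perm_def perm_fun_Perm bij_sigma_fun bij_xi_fun)

lemma standard_relations_tuples:
  assumes "n \<ge> 3"
  shows "standard_relations n (sigma_perm :: nat \<Rightarrow> (nat \<Rightarrow> 'g::group_mult) permutation) xi_perm"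
  by (rule standard_relations.intro)
    (use assms in \<open>auto simp: perm_fun_sigma_perm perm_fun_xi_perm sigma_fun_def xi_fun_def fun_eq_iff
       group_norm simp flip: perm_fun_inject\<close>)

primrec symbol_perm :: "nat \<Rightarrow> bp_symbol \<Rightarrow> (nat \<Rightarrow> 'g::group_mult) permutation" where
  "symbol_perm n Sigma_1 = sigma_perm 1"
| "symbol_perm n Sigma_prod = prod_list (map sigma_perm [1..<n])"
| "symbol_perm n Xi_1 = xi_perm 1"

lemma symbol_perm_relations:
  assumes "n \<ge> 3" "(u, v) \<in> bp_relations n"
  shows "word_lift (symbol_perm n) u = word_lift (symbol_perm n) v"
proof -
  interpret standard_relations n sigma_perm xi_perm
    by (rule standard_relations_tuples[OF assms(1)])
  have "three_generator_relations n (symbol_perm n Sigma_1) (symbol_perm n Sigma_prod) (symbol_perm n Xi_1)"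
    using three_relations by (simp add: sigma_prod_def)
  then show ?thesis
    using assms(2) bp_relations_iff by blast
qed

lemma xi_fun_comp: "xi_fun k y = y \<circ> adj k"
  by (auto simp: xi_fun_def fun_eq_iff transpose_def)

lemma sigma_fun_move: "sigma_fun k y = xi_fun k (move (k, Suc k, True) y)"
  by (auto simp: sigma_fun_def xi_fun_def move_apply letter_def fun_eq_iff)

lemma conj_gen_eq_gen:
  assumes "conj_gen k w = gen i" "normal_at k w"
  shows "k = i"
proof -
  have "inv_word w @ (k, True) # w = [(i, True)]"
    using arg_cong[OF assms(1), of Rep_fg] reduce_id[OF reduced_conj_gen[OF assms(2)]]
    unfolding conj_gen_word Rep_fg_word by (simp add: gen_def free_gen_def Abs_fg_inverse reduced_def)
  then show ?thesis
    by (cases w) auto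
qed

section \<open>Permuted tuples and their values\<close>

context standard_relations
begin

text \<open>Says that \<open>g\<close> is a value of \<open>y\<close>, once \<open>y\<close> is
  split into a permutation and a tuple with entries conjugate to their own x_i. A relation suffices
  because uniqueness of the value is used at \<open>gen\<close> only.\<close>

definition good :: "(nat \<Rightarrow> nat fg) \<Rightarrow> 'g \<Rightarrow> bool" where
  "good y g \<longleftrightarrow> (\<exists>p z. p permutes {1..n} \<and> z \<in> conj_tuples n \<and> y = z \<circ> p \<and> g = theta p * pot z)"

lemma good_gen: "good gen 1"
  unfolding good_def using permutes_id gen_conj_tuples theta_id pot_gen by (metis comp_id mult_1_left)

text \<open>In a free group x_i is a conjugate of x_(p i) only if p i = i, so the permutation in the
  splitting is trivial.\<close>

lemma good_gen_unique:
  assumes "good gen g"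
  shows "g = 1"
proof -
  obtain p z where p: "p permutes {1..n}" and z: "z \<in> conj_tuples n" and y: "gen = z \<circ> p"
    and g: "g = theta p * pot z"
    using assms unfolding good_def by blast
  have "p i = i" for i
  proof (cases "i \<in> {1..n}")
    case True
    then have "p i \<in> {1..n}"
      using permutes_in_image[OF p] by blast
    then obtain w where "normal_at (p i) w" "z (p i) = conj_gen (p i) w"
      using z unfolding conj_tuples_def by blast
    moreover have "z (p i) = gen i"
      using y by (metis comp_apply)
    ultimately show ?thesis
      using conj_gen_eq_gen by metis
  qed (use p in \<open>simp add: permutes_def\<close>)
  then have "p = id"
    by auto
  then show ?thesis
    using y g theta_id pot_gen by (metis comp_id mult_1_left)
qed

lemma good_xi:
  assumes "good y g" "1 \<le> k" "k < n"
  shows "good (xi_fun k y) (xi k * g)"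
proof -
  obtain p z where p: "p permutes {1..n}" and z: "z \<in> conj_tuples n" and y: "y = z \<circ> p"
    and g: "g = theta p * pot z"
    using assms unfolding good_def by blast
  have "xi_fun k y = z \<circ> (p \<circ> adj k)"
    by (simp only: xi_fun_comp y comp_assoc)
  moreover have "xi k * g = theta (p \<circ> adj k) * pot z"
    by (simp only: g theta_comp_adj[OF assms(2,3) p] mult.assoc)
  moreover have "p \<circ> adj k permutes {1..n}"
    using assms p by (intro permutes_compose adj_permutes)
  ultimately show ?thesis
    unfolding good_def using z by blast
qed

lemma theta_mccool_pm:
  assumes "p permutes {1..n}" "(i, j, b) \<in> moves n"
  shows "theta p * mccool_pm (p i, p j, b) = mccool_pm (i, j, b) * theta p"
proof -
  have "cnj (theta p) (mccool (p i) (p j)) = mccool i j"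
    using assms by (intro cnj_theta_mccool) (auto simp: moves_def)
  then have "cnj (theta p) (mccool_pm (p i, p j, b)) = mccool_pm (i, j, b)"
    by (simp add: mccool_pm_def cnj_minv)
  then show ?thesis
    by (rule cnj_eqD)
qed

text \<open>On \<open>z \<circ> p\<close> the move at (i, j) is the move at (p i, p j) on
  \<open>z\<close>, and conjugation by \<open>theta p\<close> relates the two group elements
  accordingly.\<close>

lemma good_move:
  assumes "good y g" and m: "(i, j, b) \<in> moves n"
  shows "good (move (i, j, b) y) (mccool_pm (i, j, b) * g)"
proof -
  obtain p z where p: "p permutes {1..n}" and z: "z \<in> conj_tuples n" and y: "y = z \<circ> p"
    and g: "g = theta p * pot z"
    using assms unfolding good_def by blast
  have inj: "p u = p v \<longleftrightarrow> u = v" for u v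
    using permutes_inj[OF p] by (simp add: inj_eq)
  have m': "(p i, p j, b) \<in> moves n"
    using m permutes_in_image[OF p] inj by (auto simp: moves_def)
  have "move (i, j, b) y = move (p i, p j, b) z \<circ> p"
    by (auto simp: move_apply y fun_eq_iff inj letter_def)
  moreover have "mccool_pm (i, j, b) * g = theta p * pot (move (p i, p j, b) z)"
    using pot_move[OF m' z] theta_mccool_pm[OF p m] by (simp add: g flip: mult.assoc)
  ultimately show ?thesis
    unfolding good_def using p move_closed[OF m' z] by blast
qed

text \<open>The inverse is included so that the property passes to inverse letters and hence to all
  words.\<close>

definition good_pair :: "(nat \<Rightarrow> nat fg) permutation \<Rightarrow> 'g \<Rightarrow> bool" where
  "good_pair P e \<longleftrightarrow> (\<forall>y g. good y g \<longrightarrow> good (perm_fun P y) (e * g) \<and> good (perm_fun (minv P) y) (minv e * g))"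

lemma good_pair_one: "good_pair 1 1"
  by (simp add: good_pair_def)

lemma good_pair_mult: "good_pair P e \<Longrightarrow> good_pair Q f \<Longrightarrow> good_pair (P * Q) (e * f)"
  by (auto simp: good_pair_def minv_mult mult.assoc)

lemma good_pair_minv: "good_pair P e \<Longrightarrow> good_pair (minv P) (minv e)"
  by (auto simp: good_pair_def)

lemma minv_xi_perm: "minv (xi_perm k) = xi_perm k"
  by (rule minv_unique) (auto simp: perm_fun_xi_perm xi_fun_def fun_eq_iff simp flip: perm_fun_inject)

lemma good_pair_xi: "1 \<le> k \<Longrightarrow> k < n \<Longrightarrow> good_pair (xi_perm k) (xi k)"
  by (auto simp: good_pair_def minv_xi_perm minv_xi perm_fun_xi_perm good_xi)

lemma perm_fun_minv_sigma_perm: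
  "perm_fun (minv (sigma_perm k)) y = move (k, Suc k, False) (xi_fun k y)"
proof -
  have "move (k, Suc k, False) (xi_fun k (sigma_fun k z)) = z" for z :: "nat \<Rightarrow> 'h::group_mult"
    by (auto simp: sigma_fun_def xi_fun_def move_apply letter_def fun_eq_iff mult.assoc)
  from this[of "perm_fun (minv (sigma_perm k)) y"] show ?thesis
    by (simp flip: perm_fun_sigma_perm)
qed

lemma good_pair_sigma:
  assumes k: "1 \<le> k" "k < n"
  shows "good_pair (sigma_perm k) (sg k)"
proof -
  have m: "(k, Suc k, b) \<in> moves n" for b
    using k by (auto simp: moves_def)
  have sg: "sg k = xi k * mccool_pm (k, Suc k, True)"
    using mccool_adjacent[OF k] xi_sq[OF k] by (simp add: mccool_pm_def flip: mult.assoc)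
  then have sg': "minv (sg k) = mccool_pm (k, Suc k, False) * xi k"
    using minv_xi[OF k] by (simp add: mccool_pm_def minv_mult)
  show ?thesis
    unfolding good_pair_def sg' unfolding sg perm_fun_minv_sigma_perm perm_fun_sigma_perm sigma_fun_move mult.assoc
    using good_xi good_move m k by blast
qed

lemma good_pair_word:
  assumes "\<And>x. good_pair (P x) (f x)"
  shows "good_pair (word_lift P w) (word_lift f w)"
proof (induction w)
  case (Cons p w)
  have "good_pair (letter P p) (letter f p)"
    using assms by (simp add: letter_def good_pair_minv)
  with Cons show ?case
    by (simp add: good_pair_mult)
qed (simp add: good_pair_one)

lemma good_pair_symbol:
  assumes "f Sigma_1 = sg 1" "f Sigma_prod = sigma_prod" "f Xi_1 = xi 1"
  shows "good_pair (symbol_perm n x) (f x)"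
proof -
  have "good_pair (prod_list (map sigma_perm ks)) (prod_list (map sg ks))" if "set ks \<subseteq> {1..<n}" for ks
    using that by (induction ks) (auto intro!: good_pair_one good_pair_mult good_pair_sigma)
  from this[of "[1..<n]"] show ?thesis
    using good_pair_sigma[of 1] good_pair_xi[of 1] n_ge_3 assms by (cases x) (simp_all add: sigma_prod_def)
qed

end

text \<open>Faithfulness: \<open>gen\<close> has the value 1, so the tuple that the word makes of it
  has the evaluation of the word as a value; if that tuple is \<open>gen\<close> again, the
  evaluation is 1.\<close>

lemma word_lift_eq_one_if_fixes_gen:
  assumes n: "n \<ge> 3"
    and rel: "\<And>u v. (u, v) \<in> bp_relations n \<Longrightarrow> word_lift f u = word_lift f v"
    and fix_gen: "perm_fun (word_lift (symbol_perm n) w) gen = gen"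
  shows "word_lift f w = (1 :: 'g::group_mult)"
proof -
  let ?a = "f Sigma_1" and ?s = "f Sigma_prod" and ?x = "f Xi_1"
  have rel': "three_generator_relations n ?a ?s ?x"
    using rel bp_relations_iff by blast
  interpret standard_relations n "conj_seq ?s ?a" "conj_seq ?s ?x"
    by (rule standard_relations_if_three[OF n rel'])
  have "good_pair (word_lift (symbol_perm n) w) (word_lift f w)"
    using standard_relations_if_three(2)[OF n rel']
    by (intro good_pair_word good_pair_symbol) (simp_all add: sigma_prod_def)
  then have "good (perm_fun (word_lift (symbol_perm n) w) gen) (word_lift f w * 1)"
    using good_gen unfolding good_pair_def by blast
  then show ?thesis
    using good_gen_unique fix_gen by simp
qed


section \<open>Automorphisms as tuples\<close>

lemma carrier_BP_auto: "g \<in> carrier (BP n) \<Longrightarrow> g \<in> auto (Fn n)"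
proof -
  interpret group "right_aut n" by (rule group_right_aut)
  have "bp_sigma n ` {1..n-1} \<union> bp_xi n ` {1..n-1} \<subseteq> carrier (right_aut n)"
    using bp_sigma_auto bp_xi_auto by (auto simp: right_aut_def AutoGroup_def)
  from generate_incl[OF this] show "g \<in> carrier (BP n) \<Longrightarrow> g \<in> auto (Fn n)"
    by (auto simp: BP_def right_aut_def AutoGroup_def)
qed

lemma BP_mult_apply:
  assumes "g \<in> carrier (BP n)" "h \<in> carrier (BP n)" "x \<in> carrier (Fn n)"
  shows "(g \<otimes>\<^bsub>BP n\<^esub> h) x = h (g x)"
  using carrier_BP_auto[OF assms(1)] carrier_BP_auto[OF assms(2)] assms(3)
  by (simp add: BP_def right_aut_def AutoGroup_def BijGroup_def auto_def compose_def)

lemma BP_one_apply: "x \<in> carrier (Fn n) \<Longrightarrow> \<one>\<^bsub>BP n\<^esub> x = x"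
  by (simp add: BP_def right_aut_def AutoGroup_def BijGroup_def)

lemma bp_generators_mem:
  assumes "1 \<le> k" "k < n"
  shows "bp_sigma n k \<in> carrier (BP n)" "bp_xi n k \<in> carrier (BP n)"
  using assms by (auto simp: BP_def intro!: generate.incl)

text \<open>Entries outside 1, ..., n are filled with \<open>gen i\<close>, so that the identity
  yields \<open>gen\<close> itself and tuples are compared as functions.\<close>

definition image_tuple :: "nat \<Rightarrow> (nat word \<Rightarrow> nat word) \<Rightarrow> nat \<Rightarrow> nat fg" where
  "image_tuple n g i = (if i \<in> {1..n} then Abs_fg (g (free_gen i)) else gen i)"

lemma image_tuple_one: "image_tuple n \<one>\<^bsub>BP n\<^esub> = gen"
  by (rule ext) (simp add: image_tuple_def BP_one_apply free_gen_in_carrier gen_def)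

lemma image_tuple_inj:
  assumes "g \<in> carrier (BP n)" "h \<in> carrier (BP n)" "image_tuple n g = image_tuple n h"
  shows "g = h"
proof -
  have hom: "g \<in> hom (Fn n) (Fn n)" "h \<in> hom (Fn n) (Fn n)"
    and ext: "g \<in> extensional (carrier (Fn n))" "h \<in> extensional (carrier (Fn n))"
    using assms carrier_BP_auto by (auto simp: auto_def Bij_def)
  have "g (free_gen i) = h (free_gen i)" if "i \<in> {1..n}" for i
  proof -
    have "g (free_gen i) \<in> carrier (Fn n)" "h (free_gen i) \<in> carrier (Fn n)"
      using hom that free_gen_in_carrier hom_in_carrier by metis+
    moreover have "Abs_fg (g (free_gen i)) = Abs_fg (h (free_gen i))"
      using fun_cong[OF assms(3), of i] that by (simp add: image_tuple_def)
    ultimately show ?thesis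
      by (metis Rep_fg_Abs)
  qed
  then have "g w = h w" if "w \<in> carrier (Fn n)" for w
    using free_hom_eqI[OF group_free_group hom _ that] by blast
  then show ?thesis
    using ext by (metis extensionalityI)
qed

lemma free_endo_gen:
  assumes "\<And>j. j \<in> {1..n} \<Longrightarrow> f j \<in> carrier (Fn n)" "i \<in> {1..n}"
  shows "free_endo n f (free_gen i) = f i"
  using assms by (simp add: free_endo_def free_gen_in_carrier free_lift_gen[OF group_free_group])

text \<open>sigma_k is applied first, so the homomorphism \<open>g\<close> evaluates the formula for
  sigma_k at its own images; left multiplication becomes a map of tuples that does not depend on
  \<open>g\<close>.\<close>

lemma image_tuple_sigma:
  assumes k: "1 \<le> k" "k < n" and g: "g \<in> carrier (BP n)"
  shows "image_tuple n (bp_sigma n k \<otimes>\<^bsub>BP n\<^esub> g) = sigma_fun k (image_tuple n g)"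
proof
  fix i
  interpret F: group "Fn n" by (rule group_free_group)
  have hom: "g \<in> hom (Fn n) (Fn n)"
    using carrier_BP_auto[OF g] by (simp add: auto_def)
  interpret g: group_hom "Fn n" "Fn n" g
    using hom by unfold_locales
  have fg: "free_gen k \<in> carrier (Fn n)" "free_gen (k + 1) \<in> carrier (Fn n)"
    using k by (auto intro: free_gen_in_carrier)
  show "image_tuple n (bp_sigma n k \<otimes>\<^bsub>BP n\<^esub> g) i = sigma_fun k (image_tuple n g) i"
  proof (cases "i \<in> {1..n}")
    case True
    have "(bp_sigma n k \<otimes>\<^bsub>BP n\<^esub> g) (free_gen i) = g (bp_sigma n k (free_gen i))"
      by (rule BP_mult_apply[OF bp_generators_mem(1)[OF k] g free_gen_in_carrier[OF True]])
    also have "bp_sigma n k (free_gen i) = (if i = k then free_gen (k + 1)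
       else if i = k + 1
         then inv\<^bsub>Fn n\<^esub> free_gen (k + 1) \<otimes>\<^bsub>Fn n\<^esub> free_gen k \<otimes>\<^bsub>Fn n\<^esub> free_gen (k + 1)
       else free_gen i)"
      unfolding bp_sigma_def using True fg
      by (intro free_endo_gen) (auto intro: free_gen_in_carrier simp del: One_nat_def)
    finally show ?thesis
      using True k fg by (auto simp: image_tuple_def sigma_fun_def Abs_fg_mult Abs_fg_inv
          simp del: One_nat_def simp flip: Suc_eq_plus1)
  next
    case False
    then show ?thesis
      using k by (auto simp: image_tuple_def sigma_fun_def)
  qed
qed

lemma image_tuple_xi:
  assumes k: "1 \<le> k" "k < n" and g: "g \<in> carrier (BP n)"
  shows "image_tuple n (bp_xi n k \<otimes>\<^bsub>BP n\<^esub> g) = xi_fun k (image_tuple n g)"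
proof
  fix i
  show "image_tuple n (bp_xi n k \<otimes>\<^bsub>BP n\<^esub> g) i = xi_fun k (image_tuple n g) i"
  proof (cases "i \<in> {1..n}")
    case True
    have "(bp_xi n k \<otimes>\<^bsub>BP n\<^esub> g) (free_gen i) = g (bp_xi n k (free_gen i))"
      by (rule BP_mult_apply[OF bp_generators_mem(2)[OF k] g free_gen_in_carrier[OF True]])
    also have "bp_xi n k (free_gen i) = (if i = k then free_gen (k + 1)
       else if i = k + 1 then free_gen k else free_gen i)"
      unfolding bp_xi_def using True k by (intro free_endo_gen) (auto intro: free_gen_in_carrier)
    finally show ?thesis
      using True k by (auto simp: image_tuple_def xi_fun_def)
  next
    case False
    then show ?thesis
      using k by (auto simp: image_tuple_def xi_fun_def)
  qed
qed

lemma image_tuple_sigma_list: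
  assumes "set ks \<subseteq> {1..<n}" "g \<in> carrier (BP n)"
  shows "foldr (monoid.mult (BP n)) (map (bp_sigma n) ks) \<one>\<^bsub>BP n\<^esub> \<in> carrier (BP n) \<and>
    image_tuple n (foldr (monoid.mult (BP n)) (map (bp_sigma n) ks) \<one>\<^bsub>BP n\<^esub> \<otimes>\<^bsub>BP n\<^esub> g) =
      perm_fun (prod_list (map sigma_perm ks)) (image_tuple n g)"
proof -
  interpret group "BP n" by (rule group_BP)
  show ?thesis
    using assms
    by (induction ks) (auto simp: bp_generators_mem m_assoc image_tuple_sigma perm_fun_sigma_perm)
qed

lemma bp_interp_mem: "n \<ge> 3 \<Longrightarrow> bp_interp n x \<in> carrier (BP n)"
  using image_tuple_sigma_list[of "[1..<n]" n "\<one>\<^bsub>BP n\<^esub>"] group.is_monoid[OF group_BP, of n] bp_generators_mem[of 1 n]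
  by (cases x) (auto simp: bp_sigma_prod_def monoid.one_closed)

lemma image_tuple_symbol:
  assumes "n \<ge> 3" "g \<in> carrier (BP n)"
  shows "image_tuple n (bp_interp n x \<otimes>\<^bsub>BP n\<^esub> g) = perm_fun (symbol_perm n x) (image_tuple n g)"
  using assms image_tuple_sigma_list[of "[1..<n]" n g]
  by (cases x) (auto simp: bp_sigma_prod_def image_tuple_sigma image_tuple_xi perm_fun_sigma_perm perm_fun_xi_perm)

lemma free_lift_bp_mem: "n \<ge> 3 \<Longrightarrow> free_lift (BP n) (bp_interp n) w \<in> carrier (BP n)"
  by (rule free_lift_in_carrier[OF group_BP, of UNIV]) (simp_all add: bp_interp_mem)

lemma image_tuple_word:
  assumes n: "n \<ge> 3"
  shows "image_tuple n (free_lift (BP n) (bp_interp n) w) = perm_fun (word_lift (symbol_perm n) w) gen"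
proof (induction w)
  case Nil
  show ?case
    by (simp add: free_lift_def image_tuple_one)
next
  case (Cons p w)
  interpret group "BP n" by (rule group_BP)
  let ?g = "free_lift (BP n) (bp_interp n) w" and ?x = "bp_interp n (fst p)"
  have mem: "?g \<in> carrier (BP n)" "?x \<in> carrier (BP n)"
    using n by (simp_all add: free_lift_bp_mem bp_interp_mem)
  have "image_tuple n ((if snd p then ?x else inv\<^bsub>BP n\<^esub> ?x) \<otimes>\<^bsub>BP n\<^esub> ?g) =
      perm_fun (letter (symbol_perm n) p) (image_tuple n ?g)"
  proof (cases "snd p")
    case True
    then show ?thesis
      using image_tuple_symbol[OF n mem(1)] by (simp add: letter_def)
  next
    case False
    have "image_tuple n ?g = image_tuple n (?x \<otimes>\<^bsub>BP n\<^esub> (inv\<^bsub>BP n\<^esub> ?x \<otimes>\<^bsub>BP n\<^esub> ?g))"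
      using mem by (simp add: m_assoc[symmetric])
    also have "\<dots> = perm_fun (symbol_perm n (fst p)) (image_tuple n (inv\<^bsub>BP n\<^esub> ?x \<otimes>\<^bsub>BP n\<^esub> ?g))"
      using mem by (intro image_tuple_symbol[OF n]) simp
    finally show ?thesis
      using False by (simp add: letter_def)
  qed
  then show ?case
    using Cons by (simp add: free_lift_def)
qed


section \<open>Recognising a presentation\<close>

lemma normal_closure_normal:
  assumes "group G" "A \<subseteq> carrier G"
  shows "normal_closure G A \<lhd> G" "A \<subseteq> normal_closure G A"
    "N \<lhd> G \<Longrightarrow> A \<subseteq> N \<Longrightarrow> normal_closure G A \<subseteq> N"
proof -
  interpret group G by fact
  let ?S = "{N. N \<lhd> G \<and> A \<subseteq> N}"
  have car: "carrier G \<in> ?S"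
    using assms(2) normal_inv_iff subgroup_self by auto
  then have eq: "normal_closure G A = \<Inter>?S"
    by (auto simp: normal_closure_def)
  have "subgroup (\<Inter>?S) G"
    using car by (intro subgroups_Inter) (auto simp: normal_def)
  then show "normal_closure G A \<lhd> G"
    unfolding eq normal_inv_iff by (auto simp: normal_inv_iff)
  show "A \<subseteq> normal_closure G A" "N \<lhd> G \<Longrightarrow> A \<subseteq> N \<Longrightarrow> normal_closure G A \<subseteq> N"
    unfolding eq by auto
qed

lemma relators_subset:
  assumes "R \<subseteq> carrier (free_group X) \<times> carrier (free_group X)"
  shows "relators X R \<subseteq> carrier (free_group X)"
proof -
  interpret group "free_group X" by (rule group_free_group)
  show ?thesis
    using assms by (auto simp: relators_def)
qed

lemma free_lift_free_gen:
  assumes "w \<in> carrier (free_group UNIV)"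
  shows "free_lift (free_group UNIV) free_gen w = w"
proof (rule free_hom_eqI[OF group_free_group _ _ _ assms])
  show "free_lift (free_group UNIV) free_gen \<in> hom (free_group UNIV) (free_group UNIV)"
    by (rule free_lift_hom[OF group_free_group]) (rule free_gen_mem_UNIV)
  show "(\<lambda>w. w) \<in> hom (free_group UNIV) (free_group UNIV)"
    by (simp add: hom_def)
qed (simp add: free_lift_gen[OF group_free_group] free_gen_mem_UNIV)

text \<open>The hypothesis is applied to the quotient by the normal closure. It cannot range over
  groups of all types, so it is stated for the one type into which Cayley's theorem embeds that
  quotient.\<close>

lemma mem_normal_closureI:
  fixes R :: "('a word \<times> 'a word) set"
  assumes R: "R \<subseteq> carrier (free_group UNIV) \<times> carrier (free_group UNIV)" and w: "w \<in> carrier (free_group UNIV)"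
    and one: "\<And>f :: 'a \<Rightarrow> 'a word set permutation.
      (\<And>u v. (u, v) \<in> R \<Longrightarrow> word_lift f u = word_lift f v) \<Longrightarrow> word_lift f w = 1"
  shows "w \<in> normal_closure (free_group UNIV) (relators UNIV R)"
proof -
  let ?F = "free_group UNIV :: 'a word monoid"
  define N where "N = normal_closure ?F (relators UNIV R)"
  interpret F: group ?F by (rule group_free_group)
  have sub: "relators UNIV R \<subseteq> carrier ?F"
    by (rule relators_subset[OF R])
  interpret N: normal N ?F
    unfolding N_def by (rule normal_closure_normal[OF F.is_group sub])
  interpret Q: group "?F Mod N" by (rule N.factorgroup_is_group)
  define c where "c u = cayley (?F Mod N) (N #>\<^bsub>?F\<^esub> u)" for u
  have hom: "(\<lambda>u. N #>\<^bsub>?F\<^esub> u) \<in> hom ?F (?F Mod N)"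
    by (rule N.r_coset_hom_Mod)
  have c_mult: "c (u \<otimes>\<^bsub>?F\<^esub> v) = c u * c v" if "u \<in> carrier ?F" "v \<in> carrier ?F" for u v
    unfolding c_def hom_mult[OF hom that] using that by (intro Q.cayley_mult hom_in_carrier[OF hom])
  have lift: "word_lift (\<lambda>x. c (free_gen x)) u = c u" if "u \<in> carrier ?F" for u
  proof -
    have "c (free_lift ?F free_gen u) = word_lift (\<lambda>x. c (free_gen x)) u"
      by (rule word_lift_free_lift[OF F.is_group free_gen_mem_UNIV c_mult])
    then show ?thesis
      by (simp only: free_lift_free_gen[OF that])
  qed
  have "word_lift (\<lambda>x. c (free_gen x)) w = 1"
  proof (rule one)
    fix u v
    assume uv: "(u, v) \<in> R"
    then have mem: "u \<in> carrier ?F" "v \<in> carrier ?F"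
      using R by auto
    have "u \<otimes>\<^bsub>?F\<^esub> inv\<^bsub>?F\<^esub> v \<in> relators UNIV R"
      using uv by (force simp: relators_def)
    then have "u \<otimes>\<^bsub>?F\<^esub> inv\<^bsub>?F\<^esub> v \<in> N"
      unfolding N_def using normal_closure_normal(2)[OF F.is_group sub] by blast
    then have "N #>\<^bsub>?F\<^esub> (u \<otimes>\<^bsub>?F\<^esub> inv\<^bsub>?F\<^esub> v) #>\<^bsub>?F\<^esub> v = N #>\<^bsub>?F\<^esub> v"
      using F.coset_join2[OF _ N.is_subgroup] mem by simp
    then have "N #>\<^bsub>?F\<^esub> u = N #>\<^bsub>?F\<^esub> v"
      using mem N.subset by (simp add: F.coset_mult_assoc F.m_assoc)
    then show "word_lift (\<lambda>x. c (free_gen x)) u = word_lift (\<lambda>x. c (free_gen x)) v"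
      unfolding lift[OF mem(1)] lift[OF mem(2)] unfolding c_def by simp
  qed
  then have "N #>\<^bsub>?F\<^esub> w = N"
    using Q.cayley_eq_one[of "N #>\<^bsub>?F\<^esub> w"] hom_in_carrier[OF hom w]
    unfolding lift[OF w] unfolding c_def by (simp add: FactGroup_def)
  then show ?thesis
    using F.coset_join1[OF _ w N.is_subgroup] by (simp add: N_def)
qed

text \<open>The first isomorphism theorem: \<open>rel\<close> puts the normal closure inside the
  kernel, and \<open>ker\<close> gives the converse inclusion.\<close>

lemma has_presentationI:
  assumes "group G" and f: "\<And>x. x \<in> X \<Longrightarrow> f x \<in> carrier G"
    and R: "R \<subseteq> carrier (free_group X) \<times> carrier (free_group X)"
    and rel: "\<And>u v. (u, v) \<in> R \<Longrightarrow> free_lift G f u = free_lift G f v"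
    and surj: "carrier G \<subseteq> free_lift G f ` carrier (free_group X)"
    and ker: "\<And>w. w \<in> carrier (free_group X) \<Longrightarrow> free_lift G f w = \<one>\<^bsub>G\<^esub> \<Longrightarrow>
      w \<in> normal_closure (free_group X) (relators X R)"
  shows "has_presentation G X f R"
proof -
  let ?F = "free_group X" and ?h = "free_lift G f"
  define N where "N = normal_closure ?F (relators X R)"
  interpret G: group G by fact
  interpret F: group ?F by (rule group_free_group)
  interpret h: group_hom ?F G ?h
    using free_lift_hom[OF G.is_group, of X f] f by unfold_locales blast
  have sub: "relators X R \<subseteq> carrier ?F"
    by (rule relators_subset[OF R])
  interpret N: normal N ?F
    unfolding N_def by (rule normal_closure_normal[OF F.is_group sub])
  have "relators X R \<subseteq> kernel ?F G ?h"
  proof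
    fix r
    assume "r \<in> relators X R"
    then obtain u v where uv: "(u, v) \<in> R" and r: "r = u \<otimes>\<^bsub>?F\<^esub> inv\<^bsub>?F\<^esub> v"
      by (auto simp: relators_def)
    then have "u \<in> carrier ?F" "v \<in> carrier ?F"
      using R by auto
    then show "r \<in> kernel ?F G ?h"
      using rel[OF uv] by (simp add: kernel_def r)
  qed
  then have kernel: "kernel ?F G ?h = N"
    unfolding N_def using normal_closure_normal(3)[OF F.is_group sub h.normal_kernel] ker
    by (auto simp: kernel_def)
  have "?h ` carrier ?F = carrier G"
    using surj h.hom_closed by blast
  from h.FactGroup_iso_set[OF this] have iso: "(\<lambda>C. the_elem (?h ` C)) \<in> iso (presented_group X R) G"
    by (simp add: kernel presented_group_def N_def)
  have "the_elem (?h ` (N #>\<^bsub>?F\<^esub> u)) = ?h u" if "u \<in> carrier ?F" for u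
  proof -
    have "?h v = ?h u" if "v \<in> N #>\<^bsub>?F\<^esub> u" for v
      using that \<open>u \<in> carrier ?F\<close> unfolding kernel[symmetric] by (auto simp: r_coset_def kernel_def)
    moreover have "u \<in> N #>\<^bsub>?F\<^esub> u"
      by (rule F.rcos_self[OF that N.is_subgroup])
    ultimately have "?h ` (N #>\<^bsub>?F\<^esub> u) = {?h u}"
      by blast
    then show ?thesis
      by simp
  qed
  then have gens: "\<forall>x\<in>X. the_elem (?h ` presented_gen X R x) = f x"
    using f by (simp add: presented_gen_def free_gen_in_carrier free_lift_gen[OF G.is_group] flip: N_def)
  then show ?thesis
    unfolding has_presentation_def by (intro conjI G.is_group bexI[OF _ iso] gens)
qed

lemma bp_relations_subset: "bp_relations n \<subseteq> carrier (free_group UNIV) \<times> carrier (free_group UNIV)"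
proof -
  interpret group "free_group (UNIV :: bp_symbol set)" by (rule group_free_group)
  show ?thesis
    by (auto simp: bp_relations_def Let_def free_gen_mem_UNIV)
qed

lemma bp_generated:
  assumes n: "n \<ge> 3"
  shows "carrier (BP n) \<subseteq> free_lift (BP n) (bp_interp n) ` carrier (free_group UNIV)"
proof
  let ?F = "free_group (UNIV :: bp_symbol set)" and ?h = "free_lift (BP n) (bp_interp n)"
  interpret F: group ?F by (rule group_free_group)
  interpret B: group "BP n" by (rule group_BP)
  interpret h: group_hom ?F "BP n" ?h
    using free_lift_hom[OF group_BP, of UNIV "bp_interp n" n] bp_interp_mem[OF n] by unfold_locales blast
  interpret A: group "right_aut n" by (rule group_right_aut)
  interpret standard_relations n "sigma_perm :: nat \<Rightarrow> (nat \<Rightarrow> nat fg) permutation" xi_perm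
    by (rule standard_relations_tuples[OF n])
  have gens: "bp_sigma n k \<in> ?h ` carrier ?F" "bp_xi n k \<in> ?h ` carrier ?F" if k: "1 \<le> k" "k < n" for k
  proof -
    \<comment> \<open>sigma_k and xi_k are the conjugates of sigma_1 and xi_1 by the power k - 1 of
      sigma. This is verified on tuples, which determine the elements of
      \<open>BP n\<close>.\<close>
    let ?w = "\<lambda>x. free_gen Sigma_prod [^]\<^bsub>?F\<^esub> (k - 1) \<otimes>\<^bsub>?F\<^esub> free_gen x \<otimes>\<^bsub>?F\<^esub>
      inv\<^bsub>?F\<^esub> (free_gen Sigma_prod [^]\<^bsub>?F\<^esub> (k - 1))"
    have w: "?w x \<in> carrier ?F" for x
      by (simp add: free_gen_mem_UNIV)
    have lift: "word_lift (symbol_perm n) (?w x) = cnj (sigma_prod ^ (k - 1)) (symbol_perm n x)" for x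
      by (simp add: word_lift_mult word_lift_inv word_lift_nat_pow free_gen_mem_UNIV cnj_def sigma_prod_def)
    have "image_tuple n (bp_sigma n k) = sigma_fun k gen" "image_tuple n (bp_xi n k) = xi_fun k gen"
      using image_tuple_sigma[OF k, of "\<one>\<^bsub>BP n\<^esub>"] image_tuple_xi[OF k, of "\<one>\<^bsub>BP n\<^esub>"] bp_generators_mem[OF k]
      by (simp_all add: image_tuple_one)
    moreover have "word_lift (symbol_perm n) (?w Sigma_1) = (sigma_perm k :: (nat \<Rightarrow> nat fg) permutation)"
      "word_lift (symbol_perm n) (?w Xi_1) = (xi_perm k :: (nat \<Rightarrow> nat fg) permutation)"
      unfolding lift using cnj_sigma_prod_power[of "k - 1"] k by simp_all
    ultimately have "?h (?w Sigma_1) = bp_sigma n k" "?h (?w Xi_1) = bp_xi n k"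
      using free_lift_bp_mem[OF n] bp_generators_mem[OF k]
      by (auto intro!: image_tuple_inj simp: image_tuple_word[OF n] perm_fun_sigma_perm perm_fun_xi_perm)
    then show "bp_sigma n k \<in> ?h ` carrier ?F" "bp_xi n k \<in> ?h ` carrier ?F"
      using w by (metis imageI)+
  qed
  have sub: "subgroup (carrier (BP n)) (right_aut n)"
  proof -
    have "bp_sigma n ` {1..n-1} \<union> bp_xi n ` {1..n-1} \<subseteq> carrier (right_aut n)"
      using bp_sigma_auto bp_xi_auto by (auto simp: right_aut_def AutoGroup_def)
    then show ?thesis
      unfolding BP_def by (simp add: A.generate_is_subgroup)
  qed
  have BP_eq: "BP n = right_aut n \<lparr>carrier := carrier (BP n)\<rparr>"
    by (simp add: BP_def)
  fix g
  assume "g \<in> carrier (BP n)"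
  then have "g \<in> generate (right_aut n) (bp_sigma n ` {1..n-1} \<union> bp_xi n ` {1..n-1})"
    by (simp add: BP_def)
  then show "g \<in> ?h ` carrier ?F"
  proof (induction g)
    case one
    have "\<one>\<^bsub>right_aut n\<^esub> = ?h \<one>\<^bsub>?F\<^esub>"
      unfolding h.hom_one by (simp add: BP_def)
    then show ?case
      by (metis F.one_closed imageI)
  next
    case (incl g)
    then show ?case
      using gens by auto
  next
    case (inv g)
    then have "g \<in> ?h ` carrier ?F"
      using gens by auto
    then obtain u where u: "u \<in> carrier ?F" "g = ?h u"
      by blast
    then have "inv\<^bsub>right_aut n\<^esub> g = inv\<^bsub>BP n\<^esub> g"
      using A.m_inv_consistent[OF sub, of g] h.hom_closed[OF u(1)] BP_eq by simp
    then have "inv\<^bsub>right_aut n\<^esub> g = ?h (inv\<^bsub>?F\<^esub> u)"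
      using u by simp
    then show ?case
      using u by (metis F.inv_closed imageI)
  next
    case (eng g g')
    then obtain u v where "u \<in> carrier ?F" "g = ?h u" "v \<in> carrier ?F" "g' = ?h v"
      by blast
    moreover from this have "g \<otimes>\<^bsub>BP n\<^esub> g' = ?h (u \<otimes>\<^bsub>?F\<^esub> v)"
      by simp
    moreover have "g \<otimes>\<^bsub>right_aut n\<^esub> g' = g \<otimes>\<^bsub>BP n\<^esub> g'"
      by (simp add: BP_def)
    ultimately show ?case
      by (metis F.m_closed imageI)
  qed
qed

theorem theorem2:
  fixes n :: nat
  assumes "n \<ge> 3"
  shows "has_presentation (BP n) (UNIV :: bp_symbol set) (bp_interp n) (bp_relations n)"
proof (rule has_presentationI)
  show "group (BP n)"
    by (rule group_BP)
  show "bp_interp n x \<in> carrier (BP n)" for x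
    by (rule bp_interp_mem[OF assms])
  show "bp_relations n \<subseteq> carrier (free_group UNIV) \<times> carrier (free_group UNIV)"
    by (rule bp_relations_subset)
  show "carrier (BP n) \<subseteq> free_lift (BP n) (bp_interp n) ` carrier (free_group UNIV)"
    by (rule bp_generated[OF assms])
  fix u v w :: "bp_symbol word"
  show "free_lift (BP n) (bp_interp n) u = free_lift (BP n) (bp_interp n) v" if "(u, v) \<in> bp_relations n"
    by (intro image_tuple_inj[of _ n])
      (simp_all only: free_lift_bp_mem image_tuple_word assms symbol_perm_relations[OF assms that])
  assume w: "w \<in> carrier (free_group UNIV)" and one: "free_lift (BP n) (bp_interp n) w = \<one>\<^bsub>BP n\<^esub>"
  have fix_gen: "perm_fun (word_lift (symbol_perm n) w) gen = gen"
    using image_tuple_word[OF assms, of w] by (simp add: one image_tuple_one)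
  show "w \<in> normal_closure (free_group UNIV) (relators UNIV (bp_relations n))"
    by (rule mem_normal_closureI[OF bp_relations_subset w])
      (rule word_lift_eq_one_if_fixes_gen[OF assms _ fix_gen])
qed

end
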